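(* Let $n\ge1$, $\delta>0$, $\beta<n$ and let $f\in L^2(T^n)$. Let $u(x,t)=v(x,t)+e^{-\alpha t}f(x)$ be the solution of $u_t=L^{\delta,\beta}u$ on $T^n$, $t>0$, $u(\cdot,0)=f$, where $\alpha=\frac{2n(n+2-\beta)}{\delta^2(n-\beta)}$ and $v$ is the function described in the context. Assume that, as $\|k\|\to\infty$, $$\hat f_k\sim\begin{cases}\dfrac{1}{\|k\|^{\beta+\epsilon}},&\text{if }\frac{n-1}{2}<\beta<n,\\[2ex] \dfrac{1}{\|k\|^{\frac{n-1}{2}+\zeta}},&\text{if }\beta\le\frac{n-1}{2},\end{cases}$$ for some $\epsilon,\zeta>0$. Then, if $f$ is discontinuous at $x$, then $u$ is discontinuous at $x$ (that is, $u(\cdot,t)$ is discontinuous at $x$ for all $t>0$).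
   Context: Let $r_1,\dots,r_n>0$ and let $T^n=\prod_{i=1}^n[0,r_i]$ be the periodic torus (opposite faces identified). For $k\in\mathbb{Z}^n$ put $\nu_k=\left(\frac{2\pi k_1}{r_1},\dots,\frac{2\pi k_n}{r_n}\right)$. A function or periodic distribution $h$ on $T^n$ is written through its Fourier coefficients as $h=\sum_{k\in\mathbb{Z}^n}\hat h_k e^{i\nu_k\cdot x}$. For $\beta<n$ the operator is $L^{\delta,\beta}u(x)=c^{\delta,\beta}\int_{B_\delta(x)}\frac{u(y)-u(x)}{\|y-x\|^\beta}dy$ with $c^{\delta,\beta}=\frac{2(n+2-\beta)\Gamma(\frac n2+1)}{\pi^{n/2}\delta^{n+2-\beta}}$ (functions extended periodically), which acts on Fourier series by multiplication of the $k$-th coefficient by $m(\nu_k)$, where $m(\nu)=c^{\delta,\beta}\int_{B_\delta(0)}\frac{\cos(\nu\cdot z)-1}{\|z\|^\beta}dz$. The solution in $L^2(T^n)$ is $\sum_k\hat f_k e^{m(\nu_k)t}e^{i\nu_k\cdot x}$. Here $f$ is a pointwise-defined square-integrable function, and $u$ is taken pointwise as $u(x,t)=v(x,t)+e^{-\alpha t}f(x)$, where $v(\cdot,t)$ is the function with Fourier coefficients $\hat v_k(t)=\hat f_k\left(1-e^{-(m(\nu_k)+\alpha)t}\right)e^{m(\nu_k)t}$, given by its continuous representative whenever one exists. The constant $\alpha$ equals $c^{\delta,\beta}\int_{B_\delta(0)}\|z\|^{-\beta}dz$. The notation $a_k\sim b_k$ as $\|k\|\to\infty$ means $a_k/b_k\to1$.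 *)

theory Defs
  imports "HOL-Analysis.Analysis" "HOL-Library.Landau_Symbols"
begin

text \<open>
  The side lengths of the torus are the components of a vector \<open>r\<close>.  Functions on the torus are
  represented by their periodic extensions to the whole space, so that continuity at a point of the
  torus (including points on the boundary of the cell) is ordinary continuity of the extension.
\<close>

definition torus_periodic :: "real ^ 'n \<Rightarrow> (real ^ 'n \<Rightarrow> 'b) \<Rightarrow> bool" where
  "torus_periodic r g \<longleftrightarrow> (\<forall>x i. g (x + axis i (r $ i)) = g x)"

definition torus_L2 :: "real ^ 'n \<Rightarrow> (real ^ 'n \<Rightarrow> complex) \<Rightarrow> bool" where
  "torus_L2 r g \<longleftrightarrow> torus_periodic r g \<and> g \<in> borel_measurable lebesgue \<and>
     set_integrable lebesgue (cbox 0 r) (\<lambda>x. (norm (g x))\<^sup>2)"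

definition torus_L2_norm :: "real ^ 'n \<Rightarrow> (real ^ 'n \<Rightarrow> complex) \<Rightarrow> real" where
  "torus_L2_norm r g = sqrt (LINT x:cbox 0 r|lebesgue. (norm (g x))\<^sup>2)"

definition freq :: "real ^ 'n \<Rightarrow> int ^ 'n \<Rightarrow> real ^ 'n" where
  "freq r k = (\<chi> i. 2 * pi * real_of_int (k $ i) / r $ i)"

definition fourier_coeff :: "real ^ 'n \<Rightarrow> (real ^ 'n \<Rightarrow> complex) \<Rightarrow> int ^ 'n \<Rightarrow> complex" where
  "fourier_coeff r g k =
     (LINT x:cbox 0 r|lebesgue. g x * exp (- \<i> * complex_of_real (freq r k \<bullet> x)))
       / complex_of_real (\<Prod>i\<in>UNIV. r $ i)"

text \<open>The Euclidean norm of an integer vector, and the filter of \<open>\<parallel>k\<parallel> \<rightarrow> \<infinity>\<close>.\<close>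

definition int_norm :: "int ^ 'n \<Rightarrow> real" where
  "int_norm k = norm (\<chi> i. real_of_int (k $ i))"

definition int_vec_at_infinity :: "(int ^ 'n) filter" where
  "int_vec_at_infinity = filtercomap int_norm at_top"

definition nonlocal_const :: "nat \<Rightarrow> real \<Rightarrow> real \<Rightarrow> real" where
  "nonlocal_const n \<delta> \<beta> =
     2 * (real n + 2 - \<beta>) * Gamma (real n / 2 + 1) /
       (pi powr (real n / 2) * \<delta> powr (real n + 2 - \<beta>))"

text \<open>
  In the two integrals below the kernel takes the value \<open>0\<close> at the centre of the ball, because
  \<open>0 powr \<beta> = 0\<close> for every \<open>\<beta>\<close> and division by zero gives zero; this is a null set.
\<close>

definition nonlocal_op ::
  "real \<Rightarrow> real \<Rightarrow> (real ^ 'n \<Rightarrow> complex) \<Rightarrow> real ^ 'n \<Rightarrow> complex" where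
  "nonlocal_op \<delta> \<beta> w x = complex_of_real (nonlocal_const CARD('n) \<delta> \<beta>) *
     (LINT y:ball x \<delta>|lebesgue. (w y - w x) / complex_of_real (norm (y - x) powr \<beta>))"

definition multiplier :: "real \<Rightarrow> real \<Rightarrow> real ^ 'n \<Rightarrow> real" where
  "multiplier \<delta> \<beta> \<nu> = nonlocal_const CARD('n) \<delta> \<beta> *
     (LINT z:ball 0 \<delta>|lebesgue. (cos (\<nu> \<bullet> z) - 1) / norm z powr \<beta>)"

text \<open>
  Solutions of \<open>u\<^sub>t = L u\<close>, \<open>u(\<cdot>,0) = f\<close> as curves in \<open>L\<^sup>2\<close>: the time derivative is the limit of
  difference quotients in the \<open>L\<^sup>2\<close> norm, and the initial value is attained in the \<open>L\<^sup>2\<close> norm.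
\<close>

definition nonlocal_solution ::
  "real ^ 'n \<Rightarrow> real \<Rightarrow> real \<Rightarrow> (real ^ 'n \<Rightarrow> complex) \<Rightarrow> (real \<Rightarrow> real ^ 'n \<Rightarrow> complex) \<Rightarrow> bool"
where
  "nonlocal_solution r \<delta> \<beta> f u \<longleftrightarrow>
     u 0 = f \<and>
     (\<forall>t\<ge>0. torus_L2 r (u t)) \<and>
     ((\<lambda>t. torus_L2_norm r (\<lambda>x. u t x - f x)) \<longlongrightarrow> 0) (at_right 0) \<and>
     (\<forall>t>0. torus_L2 r (nonlocal_op \<delta> \<beta> (u t)) \<and>
        ((\<lambda>h. torus_L2_norm r
            (\<lambda>x. (u (t + h) x - u t x) / complex_of_real h - nonlocal_op \<delta> \<beta> (u t) x))
          \<longlongrightarrow> 0) (at 0))"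

definition nonlocal_alpha :: "nat \<Rightarrow> real \<Rightarrow> real \<Rightarrow> real" where
  "nonlocal_alpha n \<delta> \<beta> = 2 * real n * (real n + 2 - \<beta>) / (\<delta>\<^sup>2 * (real n - \<beta>))"

text \<open>
  \<open>w\<close> is the function \<open>v(\<cdot>,t)\<close>.  Fourier coefficients determine it only up to null sets; the last
  conjunct selects the continuous representative when the class contains one.
\<close>

definition is_v_part ::
  "real ^ 'n \<Rightarrow> real \<Rightarrow> real \<Rightarrow> (real ^ 'n \<Rightarrow> complex) \<Rightarrow> real \<Rightarrow> (real ^ 'n \<Rightarrow> complex) \<Rightarrow> bool"
where
  "is_v_part r \<delta> \<beta> f t w \<longleftrightarrow>
     torus_L2 r w \<and>
     (\<forall>k. fourier_coeff r w k =
        fourier_coeff r f k *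
        complex_of_real
          ((1 - exp (- (multiplier \<delta> \<beta> (freq r k) + nonlocal_alpha CARD('n) \<delta> \<beta>) * t)) *
           exp (multiplier \<delta> \<beta> (freq r k) * t))) \<and>
     (\<forall>g. continuous_on UNIV g \<and> torus_periodic r g \<and> (AE x in lebesgue. g x = w x) \<longrightarrow> w = g)"

end

theory Submission
  imports Defs
begin

text \<open>
  With \<open>K(z) = \<parallel>z\<parallel>\<^sup>-\<^sup>\<beta>\<close> on the ball, the multiplier satisfies \<open>m(\<nu>) + \<alpha> = c * (transform of K)(\<nu>)\<close>, so the
  Fourier coefficients of \<open>v\<close> are bounded by a constant times \<open>a\<^sub>k * b\<^sub>k\<close>, where \<open>a\<^sub>k\<close> is the modulus of the
  coefficient of \<open>f\<close> and \<open>b\<^sub>k\<close> that of the transform of \<open>K\<close> at \<open>\<nu>\<^sub>k\<close>.  Once \<open>a\<^sub>k * b\<^sub>k\<close> is summable, \<open>v\<close>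
  is continuous and \<open>u\<close> inherits the discontinuities of \<open>f\<close>.  Pointwise asymptotics of Bessel functions
  are avoided: if \<open>2 * \<beta> < n\<close> then \<open>f\<close> and \<open>K\<close> are both square integrable and Bessel's inequality makes
  both sequences square summable.  Otherwise, on the frequencies with \<open>2^l \<le> \<parallel>k\<parallel> < 2^(l+1)\<close>, the kernel is cut
  at radius \<open>2^(-l)\<close>; the inner part is estimated by its \<open>L\<^sup>1\<close> norm, the outer part by Bessel's and the
  Cauchy-Schwarz inequality, and the decay of \<open>a\<^sub>k\<close> gives a geometric series in \<open>l\<close>.
\<close>

section \<open>Orthogonality of characters and Bessel's inequality\<close>

text \<open>Fubini for a product of one-variable functions: \<open>lborel\<close> is the image of
  the finite product of one-dimensional Lebesgue measures indexed by \<open>Basis\<close>.\<close>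

lemma integral_lborel_prod:
  fixes g :: "'a::euclidean_space \<Rightarrow> real \<Rightarrow> 'b::{real_normed_field, banach, second_countable_topology}"
  assumes "\<And>b. b \<in> Basis \<Longrightarrow> integrable lborel (g b)"
  shows "(\<integral>x. (\<Prod>b\<in>Basis. g b (x \<bullet> b)) \<partial>lborel) = (\<Prod>b\<in>Basis. \<integral>t. g b t \<partial>lborel)"
proof -
  interpret product_sigma_finite "\<lambda>b::'a. lborel :: real measure" ..
  have [measurable]: "g b \<in> borel_measurable borel" if "b \<in> Basis" for b
    using borel_measurable_integrable[OF assms[OF that]] by simp
  have "(\<integral>x. (\<Prod>b\<in>Basis. g b (x \<bullet> b)) \<partial>lborel) =
      (\<integral>h. (\<Prod>b\<in>Basis. g b (h b)) \<partial>(\<Pi>\<^sub>M b\<in>(Basis::'a set). lborel))"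
    by (subst lborel_eq, subst integral_distr) (simp_all add: inner_sum_left_Basis cong: prod.cong)
  also have "\<dots> = (\<Prod>b\<in>Basis. \<integral>t. g b t \<partial>lborel)"
    using assms by (intro product_integral_prod) auto
  finally show ?thesis .
qed

text \<open>For \<open>m\<close> nonzero the interval consists of whole periods, so the primitive
  takes the same value at both ends. The left end \<open>a\<close> is arbitrary because the cells
  used later need not start at the origin.\<close>

lemma integral_exp_period:
  fixes a l :: real and m :: int
  assumes "l > 0"
  shows "(\<integral>t. indicator {a..a+l} t *\<^sub>R exp (\<i> * complex_of_real (2 * pi * m / l * t)) \<partial>lborel)
    = (if m = 0 then complex_of_real l else 0)"
proof (cases "m = 0")
  case True
  with assms show ?thesis by (simp add: scaleR_conv_of_real)
next
  case False
  define c where "c = 2 * pi * m / l"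
  have c: "c \<noteq> 0" using False assms by (simp add: c_def)
  define F where "F = (\<lambda>t. exp (\<i> * complex_of_real (c * t)) / (\<i> * complex_of_real c))"
  have "(\<integral>t. indicator {a..a+l} t *\<^sub>R exp (\<i> * complex_of_real (c * t)) \<partial>lborel) = F (a + l) - F a"
  proof (rule integral_FTC_Icc)
    show "(F has_vector_derivative exp (\<i> * complex_of_real (c * t))) (at t within {a..a+l})" for t
    proof -
      have "((\<lambda>z. exp (\<i> * (complex_of_real c * z)) / (\<i> * complex_of_real c)) has_field_derivative
          exp (\<i> * (complex_of_real c * complex_of_real t))) (at (complex_of_real t))"
      proof -
        have "((\<lambda>z. exp (\<i> * (complex_of_real c * z))) has_field_derivative
            exp (\<i> * (complex_of_real c * complex_of_real t)) * (\<i> * complex_of_real c)) (at (complex_of_real t))"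
          by (auto intro!: derivative_eq_intros)
        from DERIV_cdivide[OF this, of "\<i> * complex_of_real c"] show ?thesis using c by simp
      qed
      from has_vector_derivative_real_field[OF this] show ?thesis
        unfolding F_def of_real_mult .
    qed
  qed (use assms in \<open>auto intro!: continuous_intros\<close>)
  also have "F (a + l) = F a"
  proof -
    have "\<i> * complex_of_real (c * (a + l)) = \<i> * complex_of_real (c * a) + of_int m * (2 * of_real pi * \<i>)"
      using assms by (simp add: c_def field_simps)
    then show ?thesis
      unfolding F_def by (simp only: exp_plus_2pin mult.assoc[symmetric]) (simp add: exp_plus_2pin algebra_simps exp_add exp_integer_2pi)
  qed
  finally show ?thesis using False by (simp add: c_def)
qed

text \<open>With \<open>S\<close> the sum of the \<open>c k * e k\<close>, orthogonality gives
  \<open>N\<close> for the integral of \<open>g * cnj S\<close> and \<open>V * N\<close> for that of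
  \<open>|S|^2\<close>. Integrating a weighted form of
  \<open>2 * Re (g * cnj S) \<le> |g|^2 + |S|^2\<close> then bounds \<open>2 * N\<close> by the
  right-hand side plus \<open>N\<close>. The \<open>e k\<close> have squared norm \<open>V\<close>,
  not 1, which explains the factor \<open>V\<close>.\<close>

lemma bessel_abstract:
  fixes g :: "'a \<Rightarrow> complex" and e :: "'k \<Rightarrow> 'a \<Rightarrow> complex" and V :: real
  assumes fin: "finite_measure M" and F: "finite F"
    and [measurable]: "g \<in> borel_measurable M" "\<And>k. e k \<in> borel_measurable M"
    and g2: "integrable M (\<lambda>x. (norm (g x))\<^sup>2)"
    and e1: "\<And>k x. norm (e k x) = 1" and V: "V > 0"
    and orth: "\<And>j k. (\<integral>x. e j x * cnj (e k x) \<partial>M) = (if j = k then complex_of_real V else 0)"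
  shows "(\<Sum>k\<in>F. (norm (\<integral>x. g x * cnj (e k x) \<partial>M))\<^sup>2) \<le> V * (\<integral>x. (norm (g x))\<^sup>2 \<partial>M)"
proof -
  interpret finite_measure M by fact
  define c where "c = (\<lambda>k. \<integral>x. g x * cnj (e k x) \<partial>M)"
  define S where "S = (\<lambda>x. \<Sum>k\<in>F. c k * e k x)"
  define N where "N = (\<Sum>k\<in>F. (norm (c k))\<^sup>2)"
  have [measurable]: "cnj \<in> borel_measurable borel"
    by (intro borel_measurable_continuous_onI continuous_intros)
  have [measurable]: "S \<in> borel_measurable M" by (simp add: S_def)
  have ge: "integrable M (\<lambda>x. g x * cnj (e k x))" for k
  proof (rule Bochner_Integration.integrable_bound[where f = "\<lambda>x. 1 + (norm (g x))\<^sup>2"])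
    \<comment> \<open>From \<open>(y - 1/2)^2 \<ge> 0\<close>. On a finite measure space this turns
      square integrability into a dominating function for the products.\<close>
    have "y \<le> 1 + y\<^sup>2" for y :: real
      using sum_power2_ge_zero[of "y - 1/2" 0] by (simp add: power2_eq_square algebra_simps)
    then show "AE x in M. norm (g x * cnj (e k x)) \<le> norm (1 + (norm (g x))\<^sup>2)"
      by (auto simp: norm_mult e1)
  qed (use g2 in auto)
  have ee: "integrable M (\<lambda>x. e j x * cnj (e k x))" for j k
    by (rule integrable_const_bound[where B = 1]) (auto simp: norm_mult e1)
  have cc: "c k * cnj (c k) = of_real ((norm (c k))\<^sup>2)" for k
    by (metis complex_norm_square)
  have gS: "integrable M (\<lambda>x. g x * cnj (S x))" "(\<integral>x. g x * cnj (S x) \<partial>M) = of_real N"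
  proof -
    have eq: "(\<lambda>x. g x * cnj (S x)) = (\<lambda>x. \<Sum>k\<in>F. cnj (c k) * (g x * cnj (e k x)))"
      by (simp add: S_def sum_distrib_left mult_ac fun_eq_iff)
    show "integrable M (\<lambda>x. g x * cnj (S x))"
      unfolding eq using ge by auto
    show "(\<integral>x. g x * cnj (S x) \<partial>M) = of_real N"
    proof -
      have "(\<integral>x. g x * cnj (S x) \<partial>M) = (\<Sum>k\<in>F. cnj (c k) * c k)"
        unfolding eq using ge by (simp add: c_def)
      then show ?thesis by (simp add: N_def cc mult.commute)
    qed
  qed
  have SS: "integrable M (\<lambda>x. S x * cnj (S x))" "(\<integral>x. S x * cnj (S x) \<partial>M) = of_real (V * N)"
  proof -
    have eq: "(\<lambda>x. S x * cnj (S x)) =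
        (\<lambda>x. \<Sum>j\<in>F. \<Sum>k\<in>F. (c j * cnj (c k)) * (e j x * cnj (e k x)))"
      by (simp add: S_def sum_product mult_ac fun_eq_iff)
    show "integrable M (\<lambda>x. S x * cnj (S x))"
      unfolding eq using ee by auto
    show "(\<integral>x. S x * cnj (S x) \<partial>M) = of_real (V * N)"
      unfolding eq using ee F
      by (simp add: orth N_def cc if_distrib sum_distrib_left mult.commute cong: if_cong)
  qed
  have Re_gS: "integrable M (\<lambda>x. Re (g x * cnj (S x)))" "(\<integral>x. Re (g x * cnj (S x)) \<partial>M) = N"
    using gS by (auto simp del: times_complex.sel)
  have S2: "(norm (S x))\<^sup>2 = Re (S x * cnj (S x))" for x
    by (metis Re_complex_of_real complex_norm_square)
  have Re_SS: "integrable M (\<lambda>x. (norm (S x))\<^sup>2)" "(\<integral>x. (norm (S x))\<^sup>2 \<partial>M) = V * N"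
    unfolding S2 using SS by (auto simp del: times_complex.sel of_real_mult)
  have "2 * N = (\<integral>x. 2 * Re (g x * cnj (S x)) \<partial>M)"
    by (subst integral_mult_right_zero) (simp only: Re_gS)
  also have "\<dots> \<le> (\<integral>x. V * (norm (g x))\<^sup>2 + (norm (S x))\<^sup>2 / V \<partial>M)"
  proof (rule integral_mono)
    fix x
    have "Re (g x * cnj (S x)) \<le> norm (g x) * norm (S x)"
      by (metis complex_Re_le_cmod complex_mod_cnj norm_mult)
    \<comment> \<open>The weight \<open>V\<close> is chosen so that the term in \<open>S\<close>
      integrates to exactly \<open>N\<close>.\<close>
    moreover have "0 \<le> (V * norm (g x) - norm (S x))\<^sup>2 / V" using V by simp
    moreover have "(V * norm (g x) - norm (S x))\<^sup>2 / V =
        V * (norm (g x))\<^sup>2 + (norm (S x))\<^sup>2 / V - 2 * (norm (g x) * norm (S x))"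
      using V by (simp add: power2_eq_square field_simps)
    ultimately show "2 * Re (g x * cnj (S x)) \<le> V * (norm (g x))\<^sup>2 + (norm (S x))\<^sup>2 / V"
      by linarith
  next
    show "integrable M (\<lambda>x. 2 * Re (g x * cnj (S x)))"
      using Re_gS(1) by (rule integrable_mult_right)
  qed (use Re_SS g2 in auto)
  also have "\<dots> = V * (\<integral>x. (norm (g x))\<^sup>2 \<partial>M) + N"
    using Re_SS g2 V by simp
  finally show ?thesis unfolding N_def c_def by simp
qed

lemma prod_Basis_vec:
  fixes h :: "real ^ 'n \<Rightarrow> 'b::comm_monoid_mult"
  shows "(\<Prod>b\<in>Basis. h b) = (\<Prod>i\<in>UNIV. h (axis i 1))"
proof -
  have "(Basis :: (real ^ 'n) set) = range (\<lambda>i. axis i 1)"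
    by (auto simp: Basis_vec_def)
  then have "(\<Prod>b\<in>Basis. h b) = prod h (range (\<lambda>i. axis i 1))"
    by (rule arg_cong)
  also have "\<dots> = (\<Prod>i\<in>UNIV. h (axis i 1))"
    by (subst prod.reindex) (auto simp: inj_on_def axis_eq_axis)
  finally show ?thesis .
qed

text \<open>The character and the indicator of the box both factor over the coordinates. A single
  nonzero component of \<open>k\<close> makes its factor vanish.\<close>

lemma set_integral_freq_exp:
  fixes r a :: "real ^ 'n" and k :: "int ^ 'n"
  assumes r: "\<And>i. r $ i > 0"
  shows "(LINT x:cbox a (a + r)|lebesgue. exp (\<i> * complex_of_real (freq r k \<bullet> x)))
    = (if k = 0 then complex_of_real (\<Prod>i\<in>UNIV. r $ i) else 0)"
proof -
  define g where "g = (\<lambda>b t. indicator {a \<bullet> b .. a \<bullet> b + r \<bullet> b} t *\<^sub>R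
    exp (\<i> * complex_of_real ((freq r k \<bullet> b) * t)))"
  have int: "integrable lborel (g b)" for b
    unfolding g_def
    by (intro borel_integrable_compact) (auto intro!: continuous_intros)
  have ind: "(\<Prod>b\<in>Basis. indicator {a \<bullet> b .. a \<bullet> b + r \<bullet> b} (x \<bullet> b)) = (indicator (cbox a (a + r)) x :: real)" for x
    by (auto simp: indicator_def mem_box inner_add_left prod_zero_iff cong: prod.cong)
  have eq: "indicator (cbox a (a + r)) x *\<^sub>R exp (\<i> * complex_of_real (freq r k \<bullet> x)) =
      (\<Prod>b\<in>Basis. g b (x \<bullet> b))" for x
  proof -
    have "exp (\<i> * complex_of_real (freq r k \<bullet> x)) =
        (\<Prod>b\<in>Basis. exp (\<i> * complex_of_real ((freq r k \<bullet> b) * (x \<bullet> b))))"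
      by (subst euclidean_inner) (simp add: sum_distrib_left exp_sum)
    then show ?thesis
      unfolding g_def scaleR_conv_of_real prod.distrib of_real_prod[symmetric] ind by simp
  qed
  have "(LINT x:cbox a (a + r)|lebesgue. exp (\<i> * complex_of_real (freq r k \<bullet> x))) =
      (\<integral>x. indicator (cbox a (a + r)) x *\<^sub>R exp (\<i> * complex_of_real (freq r k \<bullet> x)) \<partial>lborel)"
    unfolding set_lebesgue_integral_def
    by (intro integral_completion borel_measurable_scaleR borel_measurable_indicator
        borel_measurable_continuous_onI continuous_intros) auto
  also have "\<dots> = (\<Prod>b\<in>Basis. \<integral>t. g b t \<partial>lborel)"
    unfolding eq by (rule integral_lborel_prod[OF int])
  also have "\<dots> = (\<Prod>i\<in>UNIV. if k $ i = 0 then complex_of_real (r $ i) else 0)"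
    unfolding prod_Basis_vec g_def
    by (intro prod.cong refl) (simp only: inner_axis freq_def vec_lambda_beta inner_real_def mult_1_right integral_exp_period[OF r])
  also have "\<dots> = (if k = 0 then complex_of_real (\<Prod>i\<in>UNIV. r $ i) else 0)"
    by (auto simp: vec_eq_iff)
  finally show ?thesis .
qed

lemma freq_diff: "freq r (j - k) = freq r j - freq r k"
  by (simp add: freq_def vec_eq_iff diff_divide_distrib right_diff_distrib)

lemma cnj_exp_i: "cnj (exp (\<i> * complex_of_real y)) = exp (- \<i> * complex_of_real y)"
  by (simp add: exp_cnj)

lemma set_integral_freq_exp_orthogonal:
  fixes r a :: "real ^ 'n" and j k :: "int ^ 'n"
  assumes r: "\<And>i. r $ i > 0"
  shows "(LINT x:cbox a (a + r)|lebesgue.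
      exp (\<i> * complex_of_real (freq r j \<bullet> x)) * exp (- \<i> * complex_of_real (freq r k \<bullet> x)))
    = (if j = k then complex_of_real (\<Prod>i\<in>UNIV. r $ i) else 0)"
proof -
  have "exp (\<i> * complex_of_real (freq r j \<bullet> x)) * exp (- \<i> * complex_of_real (freq r k \<bullet> x))
      = exp (\<i> * complex_of_real (freq r (j - k) \<bullet> x))" for x
    by (simp add: freq_diff inner_diff_left exp_add[symmetric] algebra_simps)
  then show ?thesis
    by (simp only: set_integral_freq_exp[OF r] right_minus_eq)
qed

lemma set_integral_lebesgue_on:
  fixes g :: "'a::euclidean_space \<Rightarrow> 'b::{banach, second_countable_topology}"
  assumes "S \<in> sets lebesgue"
  shows "(LINT x:S|lebesgue. g x) = integral\<^sup>L (lebesgue_on S) g"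
  using assms by (simp add: set_lebesgue_integral_def integral_restrict_space)

lemma set_integrable_lebesgue_on:
  fixes g :: "'a::euclidean_space \<Rightarrow> 'b::{banach, second_countable_topology}"
  assumes "S \<in> sets lebesgue"
  shows "set_integrable lebesgue S g \<longleftrightarrow> integrable (lebesgue_on S) g"
  using assms by (simp add: set_integrable_def integrable_restrict_space)

lemma freq_exp_measurable [measurable]:
  "(\<lambda>x. exp (c * complex_of_real (freq r k \<bullet> x))) \<in> borel_measurable lebesgue"
proof -
  have "(\<lambda>x. exp (c * complex_of_real (freq r k \<bullet> x))) \<in> borel_measurable borel"
    by (intro borel_measurable_continuous_onI continuous_intros)
  then show ?thesis by (intro measurable_completion) simp
qed

text \<open>The characters have modulus 1 and are orthogonal on every translate of the cell, so
  \<open>bessel_abstract\<close> applies to Lebesgue measure restricted to the box.\<close>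

lemma bessel_box:
  fixes r a :: "real ^ 'n" and q :: "real ^ 'n \<Rightarrow> complex"
  assumes r: "\<And>i. r $ i > 0" and F: "finite F"
    and q: "q \<in> borel_measurable lebesgue"
    and q2: "set_integrable lebesgue (cbox a (a + r)) (\<lambda>x. (norm (q x))\<^sup>2)"
  shows "(\<Sum>k\<in>F. (norm (LINT x:cbox a (a + r)|lebesgue. q x * exp (- \<i> * complex_of_real (freq r k \<bullet> x))))\<^sup>2)
    \<le> (\<Prod>i\<in>UNIV. r $ i) * (LINT x:cbox a (a + r)|lebesgue. (norm (q x))\<^sup>2)"
proof -
  have S: "cbox a (a + r) \<in> sets lebesgue" by simp
  have "finite_measure (lebesgue_on (cbox a (a + r)))"
    by (intro finite_measure_lebesgue_on) auto
  then show ?thesis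
    unfolding set_integral_lebesgue_on[OF S] cnj_exp_i[symmetric]
  proof (rule bessel_abstract[OF _ F])
    show "(\<Prod>i\<in>UNIV. r $ i) > 0" using r by (intro prod_pos) auto
    show "(\<integral>x. exp (\<i> * complex_of_real (freq r j \<bullet> x)) * cnj (exp (\<i> * complex_of_real (freq r k \<bullet> x)))
        \<partial>lebesgue_on (cbox a (a + r))) = (if j = k then complex_of_real (\<Prod>i\<in>UNIV. r $ i) else 0)" for j k
      unfolding cnj_exp_i set_integral_lebesgue_on[OF S, symmetric]
      by (rule set_integral_freq_exp_orthogonal[OF r])
    show "integrable (lebesgue_on (cbox a (a + r))) (\<lambda>x. (norm (q x))\<^sup>2)"
      using q2 by (simp only: set_integrable_lebesgue_on[OF S])
  qed (use q in \<open>auto intro!: measurable_restrict_space1 freq_exp_measurable\<close>)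
qed

text \<open>
  The ball need not fit into one period cell.  Multiplying all side lengths by an integer \<open>N\<close> yields a
  cell containing it, and the frequencies of the original torus are among those of the larger one.
\<close>

lemma bessel_ball:
  fixes r :: "real ^ 'n"
  assumes r: "\<And>i. r $ i > 0"
  obtains V where "V > 0" and
    "\<And>(q :: real ^ 'n \<Rightarrow> complex) F. q \<in> borel_measurable lebesgue \<Longrightarrow>
      set_integrable lebesgue (ball 0 \<delta>) (\<lambda>x. (norm (q x))\<^sup>2) \<Longrightarrow> finite F \<Longrightarrow>
      (\<Sum>k\<in>F. (norm (LINT x:ball 0 \<delta>|lebesgue. q x * exp (- \<i> * complex_of_real (freq r k \<bullet> x))))\<^sup>2)
        \<le> V * (LINT x:ball 0 \<delta>|lebesgue. (norm (q x))\<^sup>2)"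
proof -
  \<comment> \<open>Each coordinate has its own threshold; there are finitely many coordinates, so
    the maximum serves for all.\<close>
  have "\<exists>N::nat. \<forall>i. 2 * \<delta> \<le> real N * r $ i"
  proof -
    have "\<exists>n. \<forall>N\<ge>n. 2 * \<delta> \<le> real N * r $ i" for i
    proof -
      obtain n :: nat where n: "2 * \<delta> / r $ i \<le> real n" using real_arch_simple by blast
      have "2 * \<delta> \<le> real N * r $ i" if "N \<ge> n" for N
        using n that r[of i] by (simp add: pos_divide_le_eq) (smt (verit) mult_right_mono of_nat_mono)
      then show ?thesis by blast
    qed
    then obtain n where "\<And>i N. N \<ge> n i \<Longrightarrow> 2 * \<delta> \<le> real N * r $ i" by metis
    then show ?thesis by (intro exI[of _ "Max (range n)"]) auto
  qed
  then obtain N0 :: nat where N0: "\<And>i. 2 * \<delta> \<le> real N0 * r $ i" by blast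
  \<comment> \<open>The successor makes \<open>N\<close> positive, so that \<open>r'\<close> has
    positive sides and \<open>s\<close> is injective.\<close>
  define N where "N = Suc N0"
  have N: "2 * \<delta> \<le> real N * r $ i" for i
    using N0[of i] r[of i] by (simp add: N_def algebra_simps)
  define r' where "r' = real N *\<^sub>R r"
  \<comment> \<open>This corner centres the enlarged cell at the origin, where the ball
    sits.\<close>
  define a where "a = - (1/2) *\<^sub>R r'"
  have r': "r' $ i > 0" for i using r by (simp add: r'_def N_def)
  have sub: "ball 0 \<delta> \<subseteq> cbox a (a + r')"
  proof
    fix x :: "real ^ 'n" assume "x \<in> ball 0 \<delta>"
    then have "\<bar>x $ i\<bar> < \<delta>" for i
      using component_le_norm_cart[of x i] by simp
    then show "x \<in> cbox a (a + r')"
      using N by (auto simp: mem_box_cart a_def r'_def abs_less_iff) (smt (verit) field_sum_of_halves)+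
  qed
  \<comment> \<open>Index \<open>s k\<close> on the enlarged torus has the frequency of
    \<open>k\<close> on the original one; injectivity of \<open>s\<close> lets the sum over
    \<open>F\<close> be read as a sum over \<open>s\<close> applied to \<open>F\<close>.\<close>
  define s where "s = (\<lambda>k :: int ^ 'n. (\<chi> i. int N * k $ i))"
  have inj: "inj s" by (auto simp: inj_def s_def vec_eq_iff N_def)
  have fr: "freq r' (s k) = freq r k" for k
    by (auto simp: freq_def vec_eq_iff s_def r'_def N_def mult.left_commute[of _ "1 + real N0"] simp del: of_nat_Suc)
  show ?thesis
  proof (rule that[of "\<Prod>i\<in>UNIV. r' $ i"])
    show "(\<Prod>i\<in>UNIV. r' $ i) > 0" using r' by (intro prod_pos) auto
    fix q :: "real ^ 'n \<Rightarrow> complex" and F :: "(int ^ 'n) set"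
    assume q[measurable]: "q \<in> borel_measurable lebesgue"
      and q2: "set_integrable lebesgue (ball 0 \<delta>) (\<lambda>x. (norm (q x))\<^sup>2)" and F: "finite F"
    define p where "p = (\<lambda>x. indicator (ball 0 \<delta>) x *\<^sub>R q x)"
    have [measurable]: "p \<in> borel_measurable lebesgue"
      unfolding p_def by (intro borel_measurable_scaleR borel_measurable_indicator q) simp
    have ind: "indicator (cbox a (a + r')) x *\<^sub>R (indicator (ball 0 \<delta>) x *\<^sub>R z) = indicator (ball 0 \<delta>) x *\<^sub>R z"
      for x and z :: "'z::real_vector" using sub by (auto simp: indicator_def)
    have p2: "(norm (p x))\<^sup>2 = indicator (ball 0 \<delta>) x *\<^sub>R (norm (q x))\<^sup>2" for x
      by (auto simp: p_def indicator_def)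
    have pe: "p x * z = indicator (ball 0 \<delta>) x *\<^sub>R (q x * z)" for x z
      by (simp add: p_def)
    have "(\<Sum>k\<in>s ` F. (norm (LINT x:cbox a (a + r')|lebesgue. p x * exp (- \<i> * complex_of_real (freq r' k \<bullet> x))))\<^sup>2)
        \<le> (\<Prod>i\<in>UNIV. r' $ i) * (LINT x:cbox a (a + r')|lebesgue. (norm (p x))\<^sup>2)"
      using q2 F by (intro bessel_box r') (simp_all only: p2 set_integrable_def ind finite_imageI, measurable)
    then show "(\<Sum>k\<in>F. (norm (LINT x:ball 0 \<delta>|lebesgue. q x * exp (- \<i> * complex_of_real (freq r k \<bullet> x))))\<^sup>2)
        \<le> (\<Prod>i\<in>UNIV. r' $ i) * (LINT x:ball 0 \<delta>|lebesgue. (norm (q x))\<^sup>2)"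
      unfolding set_lebesgue_integral_def p2 pe ind
      using inj by (simp add: sum.reindex inj_on_def inj_def fr)
  qed
qed

section \<open>Completeness of the characters\<close>

text \<open>
  The class of integrable functions with vanishing coefficients is closed under multiplication by
  characters, hence by polynomials in the coordinates of the torus embedded into \<open>\<complex>\<^sup>n\<close>; this allows the
  Stone-Weierstrass theorem to be applied to the embedded torus.
\<close>

definition fourier_null :: "real ^ 'n \<Rightarrow> (real ^ 'n \<Rightarrow> complex) \<Rightarrow> bool" where
  "fourier_null r h \<longleftrightarrow> integrable (lebesgue_on (cbox 0 r)) h \<and>
    (\<forall>k. (\<integral>x. h x * exp (- \<i> * complex_of_real (freq r k \<bullet> x)) \<partial>lebesgue_on (cbox 0 r)) = 0)"

lemma integrable_mult_freq_exp:
  assumes "integrable (lebesgue_on S) h" "S \<in> sets lebesgue"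
  shows "integrable (lebesgue_on S) (\<lambda>x. h x * exp (- \<i> * complex_of_real (freq r k \<bullet> x)))"
proof (rule Bochner_Integration.integrable_bound[OF assms(1)])
  show "(\<lambda>x. h x * exp (- \<i> * complex_of_real (freq r k \<bullet> x))) \<in> borel_measurable (lebesgue_on S)"
    by (intro borel_measurable_times borel_measurable_integrable[OF assms(1)]
        measurable_restrict_space1 freq_exp_measurable)
qed (auto simp: norm_mult)

lemma fourier_null_add:
  assumes "fourier_null r g" "fourier_null r h"
  shows "fourier_null r (\<lambda>x. g x + h x)"
  using assms integrable_mult_freq_exp[of "cbox 0 r"]
  by (auto simp: fourier_null_def distrib_right)

lemma fourier_null_cmult:
  assumes "fourier_null r h"
  shows "fourier_null r (\<lambda>x. h x * c)"
proof -
  have eq: "h x * c * exp (- \<i> * complex_of_real (freq r k \<bullet> x)) = 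
      (h x * exp (- \<i> * complex_of_real (freq r k \<bullet> x))) * c" for x k by simp
  show ?thesis using assms unfolding fourier_null_def eq by auto
qed

lemma fourier_null_sum:
  assumes "\<And>b. b \<in> B \<Longrightarrow> fourier_null r (h b)"
  shows "fourier_null r (\<lambda>x. \<Sum>b\<in>B. h b x)"
  using assms
proof (induction B rule: infinite_finite_induct)
  case (insert b B)
  then have "fourier_null r (\<lambda>x. h b x + (\<Sum>b\<in>B. h b x))"
    by (intro fourier_null_add) auto
  with insert.hyps show ?case by simp
qed (auto simp: fourier_null_def)

lemma freq_add: "freq r (j + k) = freq r j + freq r k"
  by (simp add: freq_def vec_eq_iff add_divide_distrib distrib_left)

text \<open>Multiplication by a character only shifts the index of the coefficients by
  \<open>j\<close>, and all of them vanish.\<close>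

lemma fourier_null_mult_exp:
  assumes "fourier_null r h"
  shows "fourier_null r (\<lambda>x. h x * exp (- \<i> * complex_of_real (freq r j \<bullet> x)))"
proof -
  have "h x * exp (- \<i> * complex_of_real (freq r j \<bullet> x)) * exp (- \<i> * complex_of_real (freq r k \<bullet> x)) =
      h x * exp (- \<i> * complex_of_real (freq r (j + k) \<bullet> x))" for x k
    by (simp add: freq_add inner_add_left exp_add[symmetric] algebra_simps)
  then show ?thesis
    using assms integrable_mult_freq_exp[of "cbox 0 r" h] unfolding fourier_null_def by (simp only: lmeasurable_cbox fmeasurableD) simp
qed

section \<open>The embedded torus and Stone-Weierstrass approximation\<close>

definition torus_map :: "real ^ 'n \<Rightarrow> real ^ 'n \<Rightarrow> complex ^ 'n" where
  "torus_map r x = (\<chi> i. exp (\<i> * complex_of_real (2 * pi * x $ i / r $ i)))"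

text \<open>The coordinates of the embedding are characters. The index \<open>- axis i 1\<close>
  compensates the minus sign in the form of the characters used by
  \<open>fourier_null_mult_exp\<close>.\<close>

lemma torus_map_component:
  "torus_map r x $ i = exp (- \<i> * complex_of_real (freq r (- axis i 1) \<bullet> x))"
proof -
  have "freq r (- axis i 1) = axis i (- (2 * pi / r $ i))"
    by (auto simp: freq_def vec_eq_iff axis_def)
  then show ?thesis by (simp add: torus_map_def inner_axis')
qed

lemma continuous_torus_map: "continuous_on S (torus_map r)"
  unfolding torus_map_def divide_inverse by (intro continuous_intros)

text \<open>A real linear function of the embedding is a combination of real and imaginary parts of
  its coordinates, that is, of a character and its conjugate, and both act on the class. The
  induction keeps \<open>h\<close> arbitrary so that in the product case one factor can be absorbed
  into it.\<close>

lemma fourier_null_mult_polynomial: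
  assumes "real_polynomial_function P" "fourier_null r h"
  shows "fourier_null r (\<lambda>x. h x * complex_of_real (P (torus_map r x)))"
  using assms
proof (induction P arbitrary: h rule: real_polynomial_function.induct)
  case (linear f)
  interpret f: bounded_linear f by fact
  have f: "f w = (\<Sum>b\<in>Basis. (w \<bullet> b) * f b)" for w
    by (subst euclidean_representation[of w, symmetric]) (simp only: f.sum f.scaleR real_scaleR_def)
  have "fourier_null r (\<lambda>x. h x * complex_of_real (torus_map r x \<bullet> b))" if b: "b \<in> Basis" for b
  proof -
    obtain i u where iu: "b = axis i u" "u = 1 \<or> u = \<i>"
      using b by (auto simp: Basis_vec_def Basis_complex_def)
    let ?p = "\<lambda>x. exp (- \<i> * complex_of_real (freq r (- axis i 1) \<bullet> x))"
    let ?m = "\<lambda>x. exp (- \<i> * complex_of_real (freq r (axis i 1) \<bullet> x))"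
    have neg: "freq r (- axis i 1) = - freq r (axis i 1)"
      by (simp add: freq_def vec_eq_iff)
    have m: "?m x = cnj (?p x)" for x
      by (simp add: exp_cnj neg)
    have pm: "fourier_null r (\<lambda>x. h x * ?p x * (1/2) + h x * ?m x * (1/2))"
      "fourier_null r (\<lambda>x. h x * ?p x * (1/(2*\<i>)) + h x * ?m x * (- 1/(2*\<i>)))"
      by (intro fourier_null_add fourier_null_cmult fourier_null_mult_exp linear.prems)+
    have inn: "torus_map r x \<bullet> b = ?p x \<bullet> u" for x
      by (simp only: iu inner_axis torus_map_component)
    \<comment> \<open>Real and imaginary part as half the sum, and half the difference over the
      imaginary unit, of \<open>w\<close> and \<open>cnj w\<close>.\<close>
    have re: "z * of_real (w \<bullet> 1) = z * w * (1/2) + z * cnj w * (1/2)" for z w :: complex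
      by (simp add: inner_complex_def complex_eq_iff field_simps)
    have im: "z * of_real (w \<bullet> \<i>) = z * w * (1/(2*\<i>)) + z * cnj w * (- 1/(2*\<i>))" for z w :: complex
      by (simp add: inner_complex_def complex_eq_iff field_simps Re_divide Im_divide power2_eq_square)
    show ?thesis
      using iu(2) pm unfolding inn m by (auto simp only: re im)
  qed
  then have "fourier_null r (\<lambda>x. \<Sum>b\<in>Basis. h x * complex_of_real (torus_map r x \<bullet> b) * complex_of_real (f b))"
    by (intro fourier_null_sum fourier_null_cmult)
  then show ?case
    by (subst f) (simp add: sum_distrib_left mult.assoc)
next
  case (const c)
  then show ?case by (intro fourier_null_cmult)
next
  case (add f g)
  then show ?case using fourier_null_add[of r] by (simp add: distrib_left)
next
  case (mult f g)
  have "fourier_null r (\<lambda>x. h x * complex_of_real (f (torus_map r x)) * complex_of_real (g (torus_map r x)))"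
    by (intro mult)
  then show ?case by (simp add: mult.assoc)
qed

text \<open>The image of \<open>torus_map\<close> lies in the compact product \<open>S\<close> of
  unit circles. There \<open>G\<close> is within \<open>e\<close> of a polynomial, whose integral
  against \<open>h\<close> vanishes, so the integral is at most \<open>e\<close> times the L1 norm
  \<open>I\<close> of \<open>h\<close>.\<close>

lemma integral_fourier_null_continuous:
  fixes h :: "real ^ 'n \<Rightarrow> complex" and G :: "complex ^ 'n \<Rightarrow> real"
  assumes h: "fourier_null r h" and G: "continuous_on UNIV G"
  shows "(\<integral>x. h x * complex_of_real (G (torus_map r x)) \<partial>lebesgue_on (cbox 0 r)) = 0"
proof -
  let ?M = "lebesgue_on (cbox 0 r)"
  define S where "S = {w :: complex ^ 'n. \<forall>i. norm (w $ i) = 1}"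
  have "closed S"
    unfolding S_def Collect_all_eq by (intro closed_INT ballI closed_Collect_eq continuous_intros)
  moreover have "bounded S"
  proof (rule boundedI)
    fix w assume "w \<in> S"
    then show "norm w \<le> CARD('n)"
      using L2_set_le_sum[of UNIV "\<lambda>i. norm (w $ i)"] by (auto simp: S_def norm_vec_def)
  qed
  ultimately have S: "compact S" by (simp add: compact_eq_bounded_closed)
  have inS: "torus_map r x \<in> S" for x by (simp add: S_def torus_map_def)
  have hi: "integrable ?M h" using h by (simp add: fourier_null_def)
  have Gm: "(\<lambda>x. G (torus_map r x)) \<in> borel_measurable ?M"
    by (intro measurable_restrict_space1 measurable_completion)
      (auto intro!: borel_measurable_continuous_onI continuous_on_compose2[OF G] continuous_torus_map)
  have "bounded (G ` S)"
    using S G by (meson compact_continuous_image compact_imp_bounded continuous_on_subset subset_UNIV)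
  then obtain B where B: "\<And>w. w \<in> S \<Longrightarrow> \<bar>G w\<bar> \<le> B"
    by (auto simp: bounded_iff)
  have hG: "integrable ?M (\<lambda>x. h x * complex_of_real (G (torus_map r x)))"
  proof (rule Bochner_Integration.integrable_bound[where f = "\<lambda>x. B * norm (h x)"])
    show "AE x in ?M. norm (h x * complex_of_real (G (torus_map r x))) \<le> norm (B * norm (h x))"
    proof (rule AE_I2)
      fix x
      have "norm (h x) * \<bar>G (torus_map r x)\<bar> \<le> norm (h x) * B"
        by (intro mult_left_mono B inS) simp
      then show "norm (h x * complex_of_real (G (torus_map r x))) \<le> norm (B * norm (h x))"
        by (simp add: norm_mult mult.commute)
    qed
  qed (use hi Gm in auto)
  define I where "I = (\<integral>x. norm (h x) \<partial>?M)"
  have bound: "norm (\<integral>x. h x * complex_of_real (G (torus_map r x)) \<partial>?M) \<le> e * I" if e: "e > 0" for e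
  proof -
    obtain P where P: "real_polynomial_function P" "\<And>w. w \<in> S \<Longrightarrow> \<bar>G w - P w\<bar> < e"
      using Stone_Weierstrass_real_polynomial_function[OF S continuous_on_subset[OF G] e] by blast
    have "fourier_null r (\<lambda>x. h x * complex_of_real (P (torus_map r x)))"
      by (rule fourier_null_mult_polynomial[OF P(1) h])
    \<comment> \<open>The coefficient with index 0 is the integral itself.\<close>
    then have hP: "integrable ?M (\<lambda>x. h x * complex_of_real (P (torus_map r x)))"
      "(\<integral>x. h x * complex_of_real (P (torus_map r x)) \<partial>?M) = 0"
      by (auto simp: fourier_null_def freq_def dest!: spec[of _ 0])
        (simp add: freq_def zero_vec_def[symmetric])
    have "norm (\<integral>x. h x * complex_of_real (G (torus_map r x)) \<partial>?M)
        = norm (\<integral>x. h x * complex_of_real (G (torus_map r x)) - h x * complex_of_real (P (torus_map r x)) \<partial>?M)"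
      using hG hP by simp
    also have "\<dots> \<le> (\<integral>x. e * norm (h x) \<partial>?M)"
    proof (rule Bochner_Integration.integral_norm_bound_integral)
      fix x
      have "norm (h x) * \<bar>G (torus_map r x) - P (torus_map r x)\<bar> \<le> norm (h x) * e"
        by (intro mult_left_mono less_imp_le[OF P(2)[OF inS]]) simp
      then show "norm (h x * complex_of_real (G (torus_map r x)) - h x * complex_of_real (P (torus_map r x))) \<le> e * norm (h x)"
        by (simp add: right_diff_distrib[symmetric] norm_mult mult.commute flip: of_real_diff)
    qed (use hG hP hi in auto)
    finally show ?thesis by (simp add: I_def)
  qed
  have "norm (\<integral>x. h x * complex_of_real (G (torus_map r x)) \<partial>?M) \<le> 0"
  proof (rule field_le_epsilon)
    fix e :: real assume e: "e > 0"
    have I: "I \<ge> 0" by (simp add: I_def)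
    \<comment> \<open>Dividing by \<open>I + 1\<close> instead of \<open>I\<close> covers the case
      \<open>I = 0\<close>.\<close>
    have "e / (I + 1) * I \<le> e"
      using e I by (simp add: field_simps)
    moreover have "e / (I + 1) > 0" using e I by simp
    ultimately show "norm (\<integral>x. h x * complex_of_real (G (torus_map r x)) \<partial>?M) \<le> 0 + e"
      using bound[of "e / (I + 1)"] by simp
  qed
  then show ?thesis by simp
qed

text \<open>Equal exponentials force each coordinate to differ by an integer multiple of the side
  length, while two points of the open cell differ by less than one side. On the closed cell
  opposite faces would be identified.\<close>

lemma torus_map_inj_on:
  assumes r: "\<And>i. r $ i > 0"
  shows "inj_on (torus_map r) (box 0 r)"
proof (rule inj_onI)
  fix x y assume x: "x \<in> box 0 r" and y: "y \<in> box 0 r" and eq: "torus_map r x = torus_map r y"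
  have "x $ i = y $ i" for i
  proof -
    have xy: "0 < x $ i" "x $ i < r $ i" "0 < y $ i" "y $ i < r $ i"
      using x y by (auto simp: mem_box_cart)
    have "exp (\<i> * complex_of_real (2 * pi * x $ i / r $ i)) = exp (\<i> * complex_of_real (2 * pi * y $ i / r $ i))"
      using eq by (simp add: torus_map_def vec_eq_iff)
    then obtain n :: int where "\<i> * complex_of_real (2 * pi * x $ i / r $ i) =
        \<i> * complex_of_real (2 * pi * y $ i / r $ i) + (of_int (2 * n) * pi) * \<i>"
      unfolding exp_eq by blast
    then have "2 * pi * x $ i / r $ i = 2 * pi * y $ i / r $ i + 2 * n * pi"
      by (simp add: complex_eq_iff)
    then have "(2 * pi) * (x $ i) = (2 * pi) * (y $ i + n * r $ i)"
      using r[of i] by (simp add: field_simps)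
    then have "x $ i = y $ i + n * r $ i" by (simp only: mult_cancel_left) simp
    then have "x $ i - y $ i = n * r $ i" by simp
    moreover have "\<bar>x $ i - y $ i\<bar> < r $ i" using xy by auto
    ultimately have "\<bar>real_of_int n\<bar> * r $ i < 1 * r $ i"
      using r[of i] by (simp add: abs_mult)
    then have "\<bar>real_of_int n\<bar> < 1" using r[of i] by (simp only: mult_less_cancel_right_pos)
    then have "n = 0" by linarith
    with \<open>x $ i - y $ i = n * r $ i\<close> show ?thesis by simp
  qed
  then show "x = y" by (simp add: vec_eq_iff)
qed

section \<open>From vanishing coefficients to vanishing almost everywhere\<close>

lemma AE_lebesgue_on_box:
  "AE x in lebesgue_on (cbox a b). x \<in> box a (b :: real ^ 'n)"
proof -
  have "negligible (cbox a b - box a b)" by (rule negligible_frontier_interval)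
  then have "AE x in lebesgue. x \<notin> cbox a b - box a b"
    by (intro AE_not_in) (simp add: negligible_iff_null_sets)
  then show ?thesis by (subst AE_restrict_space_iff) auto
qed

text \<open>On the open cell, membership in \<open>C\<close> can be read off from the image under
  \<open>torus_map\<close>. The indicator is there the pointwise limit of tent functions of the
  distance to the image of \<open>C\<close>; these are continuous in the embedded variable, and
  dominated convergence applies with \<open>|h|\<close> as the bound.\<close>

lemma set_integral_fourier_null_closed:
  fixes h :: "real ^ 'n \<Rightarrow> complex"
  assumes r: "\<And>i. r $ i > 0" and h: "fourier_null r h" and C: "closed C" "C \<subseteq> box 0 r"
  shows "(\<integral>x. h x * complex_of_real (indicator C x) \<partial>lebesgue_on (cbox 0 r)) = 0"
proof (cases "C = {}")
  case True
  then show ?thesis by simp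
next
  \<comment> \<open>The empty set is treated apart because \<open>infdist\<close> to it is 0 by
    convention, which would make the tents constantly 1.\<close>
  case False
  let ?M = "lebesgue_on (cbox 0 r)"
  define K where "K = torus_map r ` C"
  have "compact C" using C by (meson bounded_box bounded_subset compact_eq_bounded_closed)
  then have K: "closed K" "K \<noteq> {}"
    unfolding K_def using False by (auto intro!: compact_imp_closed compact_continuous_image continuous_torus_map)
  \<comment> \<open>The tent is 1 on \<open>K\<close> and vanishes at distance \<open>1 / m\<close>
    or more from it, for positive \<open>m\<close>.\<close>
  define G where "G = (\<lambda>(m::nat) w. max 0 (1 - real m * infdist w K))"
  have G: "continuous_on UNIV (G m)" for m
    unfolding G_def by (intro continuous_intros)
  have hi: "integrable ?M h" using h by (simp add: fourier_null_def)
  have "(\<lambda>m. \<integral>x. h x * complex_of_real (G m (torus_map r x)) \<partial>?M)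
      \<longlonglongrightarrow> (\<integral>x. h x * complex_of_real (indicator C x) \<partial>?M)"
  proof (rule integral_dominated_convergence)
    show "integrable ?M (\<lambda>x. norm (h x))" using hi by simp
    show "(\<lambda>x. h x * complex_of_real (indicator C x)) \<in> borel_measurable ?M"
      using C by (intro borel_measurable_times borel_measurable_integrable[OF hi] measurable_restrict_space1
          measurable_compose[OF borel_measurable_indicator borel_measurable_of_real]) auto
    show "(\<lambda>x. h x * complex_of_real (G m (torus_map r x))) \<in> borel_measurable ?M" for m
    proof (intro borel_measurable_times borel_measurable_integrable[OF hi])
      show "(\<lambda>x. complex_of_real (G m (torus_map r x))) \<in> borel_measurable ?M"
        by (intro measurable_restrict_space1 measurable_completion)
          (auto intro!: borel_measurable_continuous_onI continuous_on_of_real continuous_on_compose2[OF G] continuous_torus_map)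
    qed
    show "AE x in ?M. norm (h x * complex_of_real (G m (torus_map r x))) \<le> norm (h x)" for m
    proof (rule AE_I2)
      fix x
      have "norm (h x) * \<bar>G m (torus_map r x)\<bar> \<le> norm (h x) * 1"
        by (intro mult_left_mono) (auto simp: G_def infdist_nonneg)
      then show "norm (h x * complex_of_real (G m (torus_map r x))) \<le> norm (h x)"
        by (simp add: norm_mult)
    qed
    show "AE x in ?M. (\<lambda>m. h x * complex_of_real (G m (torus_map r x))) \<longlonglongrightarrow> h x * complex_of_real (indicator C x)"
      using AE_lebesgue_on_box
    proof eventually_elim
      fix x assume x: "x \<in> box 0 r"
      have mem: "torus_map r x \<in> K \<longleftrightarrow> x \<in> C"
        unfolding K_def using inj_on_image_mem_iff[OF torus_map_inj_on[OF r] x C(2)] .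
      have "(\<lambda>m. G m (torus_map r x)) \<longlonglongrightarrow> indicator C x"
      proof (cases "x \<in> C")
        case True
        then show ?thesis using mem by (simp add: G_def)
      next
        case False
        then have d: "infdist (torus_map r x) K > 0"
          using mem K by (metis in_closed_iff_infdist_zero infdist_nonneg less_eq_real_def)
        then obtain m0 :: nat where m0: "1 < real m0 * infdist (torus_map r x) K"
          using ex_less_of_nat_mult by blast
        have "G m (torus_map r x) = 0" if "m \<ge> m0" for m
        proof -
          have "real m0 * infdist (torus_map r x) K \<le> real m * infdist (torus_map r x) K"
            using that d by (intro mult_right_mono) auto
          then show ?thesis using m0 by (simp add: G_def)
        qed
        then show ?thesis
          using False by (intro tendsto_eventually) (auto simp: eventually_sequentially)
      qed
      then show "(\<lambda>m. h x * complex_of_real (G m (torus_map r x))) \<longlonglongrightarrow> h x * complex_of_real (indicator C x)"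
        by (intro tendsto_intros)
    qed
  qed
  then show ?thesis
    unfolding integral_fourier_null_continuous[OF h G] by (simp add: LIMSEQ_const_iff)
qed

text \<open>Inner regularity fills the set \<open>A\<close> where \<open>g\<close> is positive by a
  closed \<open>T\<close> up to measure \<open>e\<close>. A function positive on \<open>T\<close>
  with zero integral over it forces \<open>T\<close> to be null, so \<open>A\<close> has measure at
  most \<open>e\<close>.\<close>

lemma AE_nonpos_if_closed_integrals_zero:
  fixes g :: "'a::euclidean_space \<Rightarrow> real"
  assumes g: "integrable lebesgue g" and U: "U \<in> lmeasurable"
    and int0: "\<And>C. closed C \<Longrightarrow> C \<subseteq> U \<Longrightarrow> (LINT x:C|lebesgue. g x) = 0"
  shows "AE x in lebesgue. x \<in> U \<longrightarrow> g x \<le> 0"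
proof -
  have gm [measurable]: "g \<in> borel_measurable lebesgue" using g by simp
  define A where "A = {x \<in> U. g x > 0}"
  have "{x \<in> space lebesgue. g x > 0} \<in> sets lebesgue" by measurable
  then have A: "A \<in> sets lebesgue"
    using U sets.Int[of U lebesgue "{x. g x > 0}"] by (simp add: A_def Int_def fmeasurableD)
  have bound: "emeasure lebesgue A \<le> ennreal e" if e: "e > 0" for e
  proof -
    obtain T where T: "closed T" "T \<subseteq> A" "emeasure lebesgue (A - T) < ennreal e"
      using sets_lebesgue_inner_closed[OF A e] by metis
    have Ts: "T \<in> sets lebesgue" using T by simp
    have "(LINT x:T|lebesgue. g x) = 0" using T by (intro int0) (auto simp: A_def)
    moreover have "AE x in lebesgue. 0 \<le> indicator T x *\<^sub>R g x"
      using T by (intro AE_I2) (auto simp: indicator_def A_def)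
    moreover have "integrable lebesgue (\<lambda>x. indicator T x *\<^sub>R g x)"
      using Ts g by (rule integrable_mult_indicator)
    ultimately have "AE x in lebesgue. indicator T x *\<^sub>R g x = 0"
      unfolding set_lebesgue_integral_def using integral_nonneg_eq_0_iff_AE by blast
    then have "AE x in lebesgue. x \<notin> T"
      by eventually_elim (use T in \<open>auto simp: A_def indicator_def split: if_splits\<close>)
    then have "T \<in> null_sets lebesgue"
      using Ts AE_iff_null_sets by blast
    then have "emeasure lebesgue (A - T) = emeasure lebesgue A"
      using A by (intro emeasure_Diff_null_set)
    with T show ?thesis by simp
  qed
  have "emeasure lebesgue A \<le> 0"
    by (rule ennreal_le_epsilon) (use bound in auto)
  then have "A \<in> null_sets lebesgue" using A by auto
  then have "AE x in lebesgue. x \<notin> A" by (rule AE_not_in)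
  then show ?thesis by eventually_elim (auto simp: A_def)
qed

text \<open>Completeness of the characters. Real part, imaginary part and their negatives all have
  zero integral over closed subsets of the open cell, so all four are nonpositive almost everywhere
  there.\<close>

lemma fourier_null_imp_AE_zero:
  fixes h :: "real ^ 'n \<Rightarrow> complex"
  assumes r: "\<And>i. r $ i > 0" and h: "fourier_null r h"
  shows "AE x in lebesgue. x \<in> box 0 r \<longrightarrow> h x = 0"
proof -
  have S: "cbox 0 r \<in> sets lebesgue" by simp
  define H where "H = (\<lambda>x. indicator (cbox 0 r) x *\<^sub>R h x)"
  have H: "integrable lebesgue H"
    using h S unfolding H_def fourier_null_def by (simp add: integrable_restrict_space)
  have int0: "(\<integral>x. indicator C x *\<^sub>R H x \<partial>lebesgue) = 0" if "closed C" "C \<subseteq> box 0 r" for C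
  proof -
    have "(\<integral>x. indicator C x *\<^sub>R H x \<partial>lebesgue) = (\<integral>x. indicator (cbox 0 r) x *\<^sub>R (h x * complex_of_real (indicator C x)) \<partial>lebesgue)"
      by (intro Bochner_Integration.integral_cong) (auto simp: H_def indicator_def)
    also have "\<dots> = 0"
      using set_integral_fourier_null_closed[OF r h that] by (subst (asm) integral_restrict_space) auto
    finally show ?thesis .
  qed
  have HC: "integrable lebesgue (\<lambda>x. indicator C x *\<^sub>R H x)" if "closed C" for C :: "(real^'n) set"
    using _ H by (rule integrable_mult_indicator) (use that in simp)
  have box: "box 0 r \<in> lmeasurable" by simp
  have part: "AE x in lebesgue. x \<in> box 0 r \<longrightarrow> L (H x) \<le> 0" if L: "bounded_linear L" for L :: "complex \<Rightarrow> real"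
  proof (rule AE_nonpos_if_closed_integrals_zero[OF _ box])
    interpret L: bounded_linear L by fact
    show "integrable lebesgue (\<lambda>x. L (H x))" by (rule integrable_bounded_linear[OF L H])
    fix C :: "(real^'n) set" assume C: "closed C" "C \<subseteq> box 0 r"
    have "(LINT x:C|lebesgue. L (H x)) = (\<integral>x. L (indicator C x *\<^sub>R H x) \<partial>lebesgue)"
      by (simp add: set_lebesgue_integral_def L.scaleR)
    also have "\<dots> = 0"
      using integral_bounded_linear[OF L HC[OF C(1)]] int0[OF C] by (simp add: L.zero)
    finally show "(LINT x:C|lebesgue. L (H x)) = 0" .
  qed
  have "AE x in lebesgue. x \<in> box 0 r \<longrightarrow> H x = 0"
    using part[OF bounded_linear_Re] part[OF bounded_linear_Im]
      part[OF bounded_linear_minus[OF bounded_linear_Re]] part[OF bounded_linear_minus[OF bounded_linear_Im]]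
    by eventually_elim (auto simp: complex_eq_iff)
  then show ?thesis
    by eventually_elim (use box_subset_cbox[of 0 r] in \<open>auto simp: H_def\<close>)
qed

section \<open>Continuous representatives\<close>

lemma fourier_coeff_lebesgue_on:
  "fourier_coeff r g k = (\<integral>x. g x * exp (- \<i> * complex_of_real (freq r k \<bullet> x)) \<partial>lebesgue_on (cbox 0 r))
    / complex_of_real (\<Prod>i\<in>UNIV. r $ i)"
  unfolding fourier_coeff_def by (subst set_integral_lebesgue_on) auto

lemma torus_periodic_int_shift:
  fixes r :: "real ^ 'n" and m :: "int ^ 'n"
  assumes "torus_periodic r g"
  shows "g (x + (\<chi> i. of_int (m $ i) * r $ i)) = g x"
proof -
  have nat: "g (y + axis i (real n * r $ i)) = g y" for y i n
  proof (induction n)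
    case 0
    then show ?case by (simp add: axis_def zero_vec_def[symmetric])
  next
    case (Suc n)
    have "y + axis i (real (Suc n) * r $ i) = (y + axis i (real n * r $ i)) + axis i (r $ i)"
      by (auto simp: vec_eq_iff axis_def algebra_simps)
    then show ?case using Suc assms by (simp only: torus_periodic_def)
  qed
  have int: "g (y + axis i (of_int z * r $ i)) = g y" for y i and z :: int
  proof (cases "z \<ge> 0")
    case True
    then show ?thesis using nat[of y i "nat z"] by simp
  next
    case False
    \<comment> \<open>A negative shift is undone by \<open>nat (- z)\<close> positive periods, which
      leave \<open>g\<close> unchanged.\<close>
    have "y + axis i (of_int z * r $ i) + axis i (real (nat (- z)) * r $ i) = y"
      using False by (auto simp: vec_eq_iff axis_def algebra_simps)
    then show ?thesis using nat[of "y + axis i (of_int z * r $ i)" i "nat (- z)"] by metis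
  qed
  have "g (x + (\<Sum>i\<in>I. axis i (of_int (m $ i) * r $ i))) = g x" if "finite I" for I
    using that
  proof (induction I rule: finite_induct)
    case (insert i I)
    have "x + (\<Sum>i\<in>insert i I. axis i (of_int (m $ i) * r $ i)) =
        x + (\<Sum>i\<in>I. axis i (of_int (m $ i) * r $ i)) + axis i (of_int (m $ i) * r $ i)"
      using insert.hyps by (simp add: add_ac)
    then show ?case by (simp only: int insert.IH)
  qed simp
  from this[of UNIV] have "g (x + (\<Sum>i\<in>UNIV. axis i (of_int (m $ i) * r $ i))) = g x" by simp
  moreover have "(\<Sum>i\<in>UNIV. axis i (c i)) = (\<chi> i. c i)" for c :: "'n \<Rightarrow> real"
    by (simp add: vec_eq_iff axis_def)
  ultimately show ?thesis by (simp only:)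
qed

text \<open>The exceptional set is covered by the countably many lattice translates of its part in
  one closed cell. That part is null, since the faces of the cell are negligible.\<close>

lemma AE_eq_of_torus_periodic:
  fixes r :: "real ^ 'n" and g w :: "real ^ 'n \<Rightarrow> 'b"
  assumes r: "\<And>i. r $ i > 0" and g: "torus_periodic r g" and w: "torus_periodic r w"
    and ae: "AE x in lebesgue. x \<in> box 0 r \<longrightarrow> g x = w x"
  shows "AE x in lebesgue. g x = w x"
proof -
  define N where "N = {x \<in> cbox 0 r. g x \<noteq> w x}"
  define p where "p = (\<lambda>m :: int ^ 'n. \<chi> i. of_int (m $ i) * r $ i)"
  obtain Z where Z: "negligible Z" "{x. \<not> (x \<in> box 0 r \<longrightarrow> g x = w x)} \<subseteq> Z"
    using ae by (auto simp: eventually_ae_filter negligible_iff_null_sets)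
  have "negligible N"
    by (rule negligible_subset[OF negligible_Un[OF Z(1) negligible_frontier_interval[of 0 r]]])
      (use Z(2) in \<open>auto simp: N_def\<close>)
  then have neg: "negligible (\<Union>m. (+) (p m) ` N)"
    by (intro negligible_countable_Union) (auto intro: negligible_translation)
  have sub: "x \<in> (\<Union>m. (+) (p m) ` N)" if "g x \<noteq> w x" for x
  proof -
    \<comment> \<open>Rounding down each coordinate in units of the side length brings
      \<open>x\<close> into the cell.\<close>
    define m where "m = (\<chi> i. \<lfloor>x $ i / r $ i\<rfloor>)"
    have "x - p m \<in> cbox 0 r"
      unfolding mem_box_cart
    proof (intro allI conjI)
      fix i
      have "of_int \<lfloor>x $ i / r $ i\<rfloor> * r $ i \<le> x $ i"
        using r[of i] by (simp add: pos_le_divide_eq[symmetric])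
      then show "0 $ i \<le> (x - p m) $ i" by (simp add: p_def m_def)
      have "x $ i / r $ i \<le> of_int \<lfloor>x $ i / r $ i\<rfloor> + 1" by linarith
      then have "x $ i \<le> (of_int \<lfloor>x $ i / r $ i\<rfloor> + 1) * r $ i"
        using pos_divide_le_eq[OF r[of i]] by blast
      then show "(x - p m) $ i \<le> r $ i" by (simp add: p_def m_def algebra_simps)
    qed
    moreover have "g (x - p m) = g x" "w (x - p m) = w x"
      using torus_periodic_int_shift[OF g, of "x - p m" m] torus_periodic_int_shift[OF w, of "x - p m" m]
      by (simp_all add: p_def)
    ultimately have "x - p m \<in> N" using that by (simp add: N_def)
    then have "x \<in> (+) (p m) ` N" by (intro image_eqI[of _ _ "x - p m"]) auto
    then show ?thesis by blast
  qed
  show ?thesis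
    by (rule AE_I'[of "\<Union>m. (+) (p m) ` N"]) (use neg sub in \<open>auto simp: negligible_iff_null_sets\<close>)
qed

text \<open>The Weierstrass M-test gives uniform convergence along finite sets of indices, hence
  continuity of the sum and integration term by term against each character.\<close>

lemma fourier_series_continuous:
  fixes r :: "real ^ 'n" and c :: "int ^ 'n \<Rightarrow> complex"
  assumes r: "\<And>i. r $ i > 0" and c: "(\<lambda>k. norm (c k)) summable_on UNIV"
  obtains g where "continuous_on UNIV g" "torus_periodic r g" "\<And>k. fourier_coeff r g k = c k"
proof -
  let ?e = "\<lambda>k x. exp (\<i> * complex_of_real (freq r k \<bullet> x))"
  let ?M = "lebesgue_on (cbox 0 r)"
  define V where "V = complex_of_real (\<Prod>i\<in>UNIV. r $ i)"
  have V: "V \<noteq> 0" using r by (simp add: V_def less_imp_neq[symmetric])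
  define g where "g = (\<lambda>x. \<Sum>\<^sub>\<infinity>k. c k * ?e k x)"
  have unif: "uniform_limit UNIV (\<lambda>X x. \<Sum>k\<in>X. c k * ?e k x) g (finite_subsets_at_top UNIV)"
    unfolding g_def by (rule Weierstrass_m_test_general[OF _ c]) (simp add: norm_mult)
  have cont: "continuous_on UNIV g"
    by (rule uniform_limit_theorem[OF _ unif]) (auto intro!: always_eventually continuous_intros)
  have "?e k (x + axis i (r $ i)) = ?e k x" for k x i
  proof -
    have "freq r k \<bullet> axis i (r $ i) = of_int (k $ i) * (2 * pi)"
      using r[of i] by (simp add: inner_axis freq_def)
    then have "\<i> * complex_of_real (freq r k \<bullet> (x + axis i (r $ i))) =
        \<i> * complex_of_real (freq r k \<bullet> x) + (of_int (2 * (k $ i)) * pi) * \<i>"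
      by (simp add: inner_add_right distrib_left)
    then show ?thesis unfolding exp_eq by blast
  qed
  then have per: "torus_periodic r g"
    by (simp add: torus_periodic_def g_def)
  have int: "integrable ?M F" if "continuous_on UNIV F" for F :: "real ^ 'n \<Rightarrow> 'z::euclidean_space"
    using that by (intro continuous_imp_integrable continuous_on_subset[OF that]) auto
  have "fourier_coeff r g k = c k" for k
  proof -
    \<comment> \<open>A character has modulus 1, so multiplying by it leaves the distance to the
      limit unchanged.\<close>
    have unif': "uniform_limit UNIV (\<lambda>X x. \<Sum>j\<in>X. (c j * ?e j x) * cnj (?e k x))
        (\<lambda>x. g x * cnj (?e k x)) (finite_subsets_at_top UNIV)"
    proof (rule uniform_limitI)
      fix d :: real assume "d > 0"
      from uniform_limitD[OF unif this]
      show "\<forall>\<^sub>F X in finite_subsets_at_top UNIV.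
          \<forall>x\<in>UNIV. dist (\<Sum>j\<in>X. (c j * ?e j x) * cnj (?e k x)) (g x * cnj (?e k x)) < d"
        by eventually_elim
          (simp add: dist_norm sum_distrib_right[symmetric] left_diff_distrib[symmetric] norm_mult)
    qed
    have lim: "((\<lambda>X. \<integral>x. (\<Sum>j\<in>X. (c j * ?e j x) * cnj (?e k x)) \<partial>?M) \<longlongrightarrow> (\<integral>x. g x * cnj (?e k x) \<partial>?M))
        (finite_subsets_at_top UNIV)"
    proof (rule tendstoI)
      fix d :: real assume d: "d > 0"
      define v where "v = measure ?M (space ?M)"
      have v: "v \<ge> 0" by (simp add: v_def)
      \<comment> \<open>The cell has measure \<open>v\<close>; with \<open>v + 1\<close> in the
        denominator the integral of this tolerance stays strictly below \<open>d\<close>.\<close>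
      have "d / (v + 1) > 0" using d v by simp
      from uniform_limitD[OF unif' this]
      show "\<forall>\<^sub>F X in finite_subsets_at_top UNIV.
          dist (\<integral>x. (\<Sum>j\<in>X. (c j * ?e j x) * cnj (?e k x)) \<partial>?M) (\<integral>x. g x * cnj (?e k x) \<partial>?M) < d"
      proof eventually_elim
        fix X assume X: "\<forall>x\<in>UNIV. dist (\<Sum>j\<in>X. (c j * ?e j x) * cnj (?e k x)) (g x * cnj (?e k x)) < d / (v + 1)"
        have "dist (\<integral>x. (\<Sum>j\<in>X. (c j * ?e j x) * cnj (?e k x)) \<partial>?M) (\<integral>x. g x * cnj (?e k x) \<partial>?M)
            = norm (\<integral>x. (\<Sum>j\<in>X. (c j * ?e j x) * cnj (?e k x)) - g x * cnj (?e k x) \<partial>?M)"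
          unfolding dist_norm by (subst Bochner_Integration.integral_diff) (auto intro!: int continuous_intros cont)
        also have "\<dots> \<le> (\<integral>x. d / (v + 1) \<partial>?M)"
          by (rule Bochner_Integration.integral_norm_bound_integral)
            (use X in \<open>auto intro!: int continuous_intros cont less_imp_le simp: dist_norm\<close>)
        also have "\<dots> = v * (d / (v + 1))" by (simp add: v_def)
        also have "\<dots> < d" using d v by (simp add: field_simps)
        finally show "dist (\<integral>x. (\<Sum>j\<in>X. (c j * ?e j x) * cnj (?e k x)) \<partial>?M) (\<integral>x. g x * cnj (?e k x) \<partial>?M) < d" .
      qed
    qed
    \<comment> \<open>Once the finite set contains \<open>k\<close>, orthogonality makes the
      integral exactly \<open>c k * V\<close>, so the limit is that value.\<close>
    have ev: "\<forall>\<^sub>F X in finite_subsets_at_top UNIV.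
        (\<integral>x. (\<Sum>j\<in>X. (c j * ?e j x) * cnj (?e k x)) \<partial>?M) = c k * V"
      unfolding eventually_finite_subsets_at_top
    proof (intro exI[of _ "{k}"] conjI allI impI)
      fix Y :: "(int ^ 'n) set" assume Y: "finite Y \<and> {k} \<subseteq> Y \<and> Y \<subseteq> UNIV"
      have orth: "(\<integral>x. ?e j x * cnj (?e k x) \<partial>?M) = (if j = k then V else 0)" for j
        using set_integral_freq_exp_orthogonal[OF r, of 0 j k]
        unfolding cnj_exp_i V_def by (subst (asm) set_integral_lebesgue_on) auto
      have "(\<integral>x. (\<Sum>j\<in>Y. (c j * ?e j x) * cnj (?e k x)) \<partial>?M) = (\<Sum>j\<in>Y. \<integral>x. c j * (?e j x * cnj (?e k x)) \<partial>?M)"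
        unfolding mult.assoc by (intro Bochner_Integration.integral_sum int continuous_intros)
      also have "\<dots> = (\<Sum>j\<in>Y. if j = k then c k * V else 0)"
        by (intro sum.cong refl) (subst Bochner_Integration.integral_mult_right_zero, simp only: orth, simp)
      finally show "(\<integral>x. (\<Sum>j\<in>Y. (c j * ?e j x) * cnj (?e k x)) \<partial>?M) = c k * V"
        using Y by simp
    qed auto
    have "(\<integral>x. g x * cnj (?e k x) \<partial>?M) = c k * V"
      by (rule tendsto_unique[OF finite_subsets_at_top_neq_bot lim tendsto_eventually[OF ev]])
    then show ?thesis
      using V unfolding fourier_coeff_lebesgue_on V_def[symmetric] cnj_exp_i by simp
  qed
  with cont per that show ?thesis by blast
qed

lemma torus_L2_integrable:
  assumes "torus_L2 r w"
  shows "integrable (lebesgue_on (cbox 0 r)) w"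
proof -
  interpret finite_measure "lebesgue_on (cbox 0 r)"
    by (intro finite_measure_lebesgue_on) auto
  have w: "w \<in> borel_measurable lebesgue"
    and w2: "integrable (lebesgue_on (cbox 0 r)) (\<lambda>x. (norm (w x))\<^sup>2)"
    using assms by (auto simp: torus_L2_def set_integrable_lebesgue_on)
  show ?thesis
  proof (rule Bochner_Integration.integrable_bound[where f = "\<lambda>x. 1 + (norm (w x))\<^sup>2"])
    have "y \<le> 1 + y\<^sup>2" for y :: real
      using sum_power2_ge_zero[of "y - 1/2" 0] by (simp add: power2_eq_square algebra_simps)
    then show "AE x in lebesgue_on (cbox 0 r). norm (w x) \<le> norm (1 + (norm (w x))\<^sup>2)"
      by auto
  qed (use w w2 in \<open>auto intro: measurable_restrict_space1\<close>)
qed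

text \<open>The sum \<open>g\<close> of the Fourier series has the coefficients of \<open>w\<close>,
  so \<open>g - w\<close> vanishes almost everywhere in the cell by completeness, and elsewhere by
  periodicity.\<close>

lemma continuous_representative_of_summable_coeffs:
  fixes r :: "real ^ 'n"
  assumes r: "\<And>i. r $ i > 0" and w: "torus_L2 r w"
    and sum: "(\<lambda>k. norm (fourier_coeff r w k)) summable_on UNIV"
  obtains g where "continuous_on UNIV g" "torus_periodic r g" "AE x in lebesgue. g x = w x"
proof -
  obtain g where g: "continuous_on UNIV g" "torus_periodic r g"
    "\<And>k. fourier_coeff r g k = fourier_coeff r w k"
    using fourier_series_continuous[OF r sum] by blast
  have ig: "integrable (lebesgue_on (cbox 0 r)) g"
    by (intro continuous_imp_integrable continuous_on_subset[OF g(1)]) auto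
  have V: "complex_of_real (\<Prod>i\<in>UNIV. r $ i) \<noteq> 0"
    using r by (simp add: less_imp_neq[symmetric])
  have "(\<integral>x. (g x - w x) * exp (- \<i> * complex_of_real (freq r k \<bullet> x)) \<partial>lebesgue_on (cbox 0 r)) = 0" for k
    using g(3)[of k] V integrable_mult_freq_exp[OF ig, of r k] 
      integrable_mult_freq_exp[OF torus_L2_integrable[OF w], of r k]
    unfolding fourier_coeff_lebesgue_on left_diff_distrib
    by (subst Bochner_Integration.integral_diff) auto
  then have "fourier_null r (\<lambda>x. g x - w x)"
    using ig torus_L2_integrable[OF w] by (simp add: fourier_null_def)
  then have "AE x in lebesgue. x \<in> box 0 r \<longrightarrow> g x - w x = 0"
    by (rule fourier_null_imp_AE_zero[OF r])
  then have "AE x in lebesgue. g x = w x"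
    using w g(2) by (intro AE_eq_of_torus_periodic[OF r]) (auto simp: torus_L2_def)
  with g that show ?thesis by blast
qed

section \<open>Radial integrals\<close>

text \<open>Polar coordinates for radial functions without a measure on the sphere: the image of
  Lebesgue measure on the ball under \<open>norm\<close> and the measure with density
  \<open>n * unit_ball_vol n * t ^ (n - 1)\<close> agree on all half-lines, where both are
  differences of volumes of balls.\<close>

lemma nn_integral_ball_norm:
  fixes \<phi> :: "real \<Rightarrow> ennreal"
  assumes \<delta>: "\<delta> > 0" and [measurable]: "\<phi> \<in> borel_measurable borel"
  defines "n \<equiv> DIM('a::euclidean_space)"
  shows "(\<integral>\<^sup>+x\<in>ball 0 \<delta>. \<phi> (norm (x::'a)) \<partial>lborel) =
    (\<integral>\<^sup>+t\<in>{0..\<delta>}. ennreal (n * unit_ball_vol n * t ^ (n - 1)) * \<phi> t \<partial>lborel)"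
proof -
  define M where "M = distr (density lborel (indicator (ball (0::'a) \<delta>))) borel norm"
  define N where "N = density lborel (\<lambda>t. ennreal (n * unit_ball_vol n * t ^ (n - 1)) * indicator {0..\<delta>} t)"
  have n: "n > 0" by (simp add: n_def)
  have vol: "unit_ball_vol (real n) > 0" by simp
  have eq: "emeasure M {x<..} = emeasure N {x<..} \<and> emeasure M {x<..} < \<infinity>" for x :: real
  proof -
    \<comment> \<open>Clamping \<open>x\<close> to the interval from 0 to \<delta> treats all
      half-lines at once.\<close>
    define y where "y = max 0 (min x \<delta>)"
    have y: "0 \<le> y" "y \<le> \<delta>" using \<delta> by (auto simp: y_def)
    have [measurable]: "norm -` {x<..} \<in> sets (borel :: 'a measure)"
      using measurable_sets[of norm borel borel "{x<..}"] by simp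
    have "emeasure M {x<..} = (\<integral>\<^sup>+z. indicator (ball (0::'a) \<delta>) z * indicator {z. x < norm z} z \<partial>lborel)"
      unfolding M_def
      by (subst emeasure_distr, simp, simp, subst emeasure_density)
        (auto intro!: nn_integral_cong borel_measurable_indicator simp: indicator_def)
    also have "\<dots> = emeasure lborel (ball (0::'a) \<delta> \<inter> {z. x < norm z})"
      by (simp add: indicator_inter_arith[symmetric])
    also have "\<dots> = emeasure lborel (ball (0::'a) \<delta> - cball 0 y)"
    proof (rule emeasure_eq_AE)
      \<comment> \<open>For negative \<open>x\<close> the two sets differ at the origin.\<close>
      have "AE z in lborel. z \<noteq> (0::'a)" by (rule AE_lborel_singleton)
      then show "AE z in lborel. z \<in> ball (0::'a) \<delta> \<inter> {z. x < norm z} \<longleftrightarrow> z \<in> ball (0::'a) \<delta> - cball 0 y"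
      proof eventually_elim
        case (elim z)
        then have "norm z > 0" by simp
        then show ?case using \<delta> by (auto simp: y_def max_def min_def not_le intro: less_trans split: if_splits)
      qed
      have "{z::'a. x < norm z} = norm -` {x<..}" by auto
      then show "ball (0::'a) \<delta> \<inter> {z. x < norm z} \<in> sets lborel"
        by (simp add: sets.Int)
      show "ball (0::'a) \<delta> - cball 0 y \<in> sets lborel"
        by (simp add: sets.Diff)
    qed
    also have "\<dots> = ennreal (unit_ball_vol n * \<delta> ^ n - unit_ball_vol n * y ^ n)"
    proof (cases "y = \<delta>")
      case True
      then have "ball (0::'a) \<delta> - cball 0 y = {}" by auto
      then have "emeasure lborel (ball (0::'a) \<delta> - cball 0 y) = 0" by (simp only: emeasure_empty)
      then show ?thesis using True by simp
    next
      case False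
      with y have "y < \<delta>" by simp
      then have "cball (0::'a) y \<subseteq> ball 0 \<delta>" by (intro subsetI) simp
      then have "emeasure lborel (ball (0::'a) \<delta> - cball 0 y) = emeasure lborel (ball (0::'a) \<delta>) - emeasure lborel (cball (0::'a) y)"
        by (rule emeasure_Diff[rotated 3]) (use emeasure_lborel_cball_finite[of "0::'a" y] in \<open>simp_all add: less_top\<close>)
      also have "\<dots> = ennreal (unit_ball_vol n * \<delta> ^ n) - ennreal (unit_ball_vol n * y ^ n)"
        using y \<delta> by (simp add: emeasure_ball emeasure_cball n_def)
      also have "\<dots> = ennreal (unit_ball_vol n * \<delta> ^ n - unit_ball_vol n * y ^ n)"
        using y vol by (intro ennreal_minus) simp
      finally show ?thesis .
    qed
    finally have M: "emeasure M {x<..} = ennreal (unit_ball_vol n * \<delta> ^ n - unit_ball_vol n * y ^ n)" .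
    have "emeasure N {x<..} = (\<integral>\<^sup>+t. ennreal (n * unit_ball_vol n * t ^ (n - 1)) * indicator {0..\<delta>} t * indicator {x<..} t \<partial>lborel)"
      unfolding N_def by (subst emeasure_density) auto
    also have "\<dots> = (\<integral>\<^sup>+t. ennreal (n * unit_ball_vol n * t ^ (n - 1)) * indicator {y..\<delta>} t \<partial>lborel)"
    proof (rule nn_integral_cong_AE)
      \<comment> \<open>The two indicators can differ only at the endpoint \<open>y\<close>.\<close>
      have "AE t in lborel. t \<noteq> y" by (rule AE_lborel_singleton)
      then show "AE t in lborel. ennreal (n * unit_ball_vol n * t ^ (n - 1)) * indicator {0..\<delta>} t * indicator {x<..} t
          = ennreal (n * unit_ball_vol n * t ^ (n - 1)) * indicator {y..\<delta>} t"
        by eventually_elim (auto simp: y_def indicator_def)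
    qed
    also have "\<dots> = ennreal (unit_ball_vol n * \<delta> ^ n - unit_ball_vol n * y ^ n)"
    proof (rule nn_integral_FTC_Icc)
      show "((\<lambda>t. unit_ball_vol n * t ^ n) has_real_derivative n * unit_ball_vol n * t ^ (n - 1)) (at t)" for t
        by (auto intro!: derivative_eq_intros)
      show "0 \<le> n * unit_ball_vol n * t ^ (n - 1)" if "t \<in> {y..\<delta>}" for t
        using y vol that by simp
    qed (use y in auto)
    finally show ?thesis using M by simp
  qed
  have "M = N"
  proof (rule measure_eqI_lessThan)
    show "sets M = sets borel" "sets N = sets borel" by (simp_all add: M_def N_def)
    show "emeasure M {x<..} < \<infinity>" "emeasure M {x<..} = emeasure N {x<..}" for x
      using eq[of x] by blast+
  qed
  then have "integral\<^sup>N M \<phi> = integral\<^sup>N N \<phi>" by simp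
  moreover have "integral\<^sup>N M \<phi> = (\<integral>\<^sup>+x\<in>ball 0 \<delta>. \<phi> (norm (x::'a)) \<partial>lborel)"
    unfolding M_def
    by (subst nn_integral_distr, simp, simp, subst nn_integral_density)
      (simp_all add: borel_measurable_indicator mult.commute)
  moreover have "integral\<^sup>N N \<phi> =
      (\<integral>\<^sup>+t\<in>{0..\<delta>}. ennreal (n * unit_ball_vol n * t ^ (n - 1)) * \<phi> t \<partial>lborel)"
    unfolding N_def by (subst nn_integral_density) (simp_all add: mult.commute mult.left_commute)
  ultimately show ?thesis by simp
qed

text \<open>In the radial variable the integrand becomes a multiple of
  \<open>t powr (n - 1 - \<gamma>)\<close>, which is integrable at 0 because \<gamma> is below the
  dimension.\<close>

lemma has_bochner_integral_ball_norm_powr: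
  fixes \<delta> \<gamma> :: real
  assumes \<delta>: "\<delta> > 0" and \<gamma>: "\<gamma> < DIM('a::euclidean_space)"
  shows "has_bochner_integral lebesgue (\<lambda>x::'a. indicator (ball 0 \<delta>) x *\<^sub>R norm x powr (- \<gamma>))
    (DIM('a) * unit_ball_vol DIM('a) * \<delta> powr (DIM('a) - \<gamma>) / (DIM('a) - \<gamma>))"
proof -
  let ?n = "DIM('a)"
  have "(\<integral>\<^sup>+x. ennreal (indicator (ball 0 \<delta>) x *\<^sub>R norm x powr (- \<gamma>)) \<partial>(lborel :: 'a measure)) =
      (\<integral>\<^sup>+x\<in>ball 0 \<delta>. ennreal (norm (x::'a) powr (- \<gamma>)) \<partial>lborel)"
    by (intro nn_integral_cong) (auto simp: indicator_def)
  also have "\<dots> = (\<integral>\<^sup>+t\<in>{0..\<delta>}. ennreal (?n * unit_ball_vol ?n * t ^ (?n - 1)) * ennreal (t powr (- \<gamma>)) \<partial>lborel)"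
    using nn_integral_ball_norm[OF \<delta>, of "\<lambda>t. ennreal (t powr (- \<gamma>))"] by simp
  also have "\<dots> = (\<integral>\<^sup>+t. ennreal (?n * unit_ball_vol ?n * t powr (?n - 1 - \<gamma>)) * indicator {0..\<delta>} t \<partial>lborel)"
  proof (rule nn_integral_cong)
    fix t :: real
    \<comment> \<open>At \<open>t = 0\<close> both sides vanish since \<open>0 powr c = 0\<close>,
      even in dimension one where \<open>0 ^ 0 = 1\<close>.\<close>
    have "t ^ (?n - 1) * t powr (- \<gamma>) = t powr (?n - 1 - \<gamma>)" if "t \<ge> 0"
    proof (cases "t = 0")
      case False
      then have "t ^ (?n - 1) * t powr (- \<gamma>) = t powr real (?n - 1) * t powr (- \<gamma>)"
        using that by (subst powr_realpow) auto
      also have "\<dots> = t powr (?n - 1 - \<gamma>)"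
        by (simp add: powr_add[symmetric] of_nat_diff DIM_ge_Suc0)
      finally show ?thesis .
    qed simp
    then show "ennreal (?n * unit_ball_vol ?n * t ^ (?n - 1)) * ennreal (t powr (- \<gamma>)) * indicator {0..\<delta>} t
        = ennreal (?n * unit_ball_vol ?n * t powr (?n - 1 - \<gamma>)) * indicator {0..\<delta>} t"
      by (auto simp: indicator_def ennreal_mult'[symmetric] mult.assoc)
  qed
  also have "\<dots> = ennreal (?n * unit_ball_vol ?n * (\<delta> powr (?n - 1 - \<gamma> + 1) / (?n - 1 - \<gamma> + 1)))"
    using \<gamma> \<delta>
    by (intro nn_integral_has_integral_lebesgue' has_integral_mult_right has_integral_powr_from_0) auto
  also have "\<dots> = ennreal (?n * unit_ball_vol ?n * \<delta> powr (?n - \<gamma>) / (?n - \<gamma>))"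
    by simp
  finally have "has_bochner_integral lborel (\<lambda>x::'a. indicator (ball 0 \<delta>) x *\<^sub>R norm x powr (- \<gamma>))
    (?n * unit_ball_vol ?n * \<delta> powr (?n - \<gamma>) / (?n - \<gamma>))"
    using \<gamma> by (intro has_bochner_integral_nn_integral) (measurable, auto)
  then show ?thesis
    by (auto simp: has_bochner_integral_iff integrable_completion integral_completion dest: borel_measurable_integrable)
qed

text \<open>Reconciles the closed form of \<alpha> with its description as a kernel integral: the
  powers of pi and the Gamma values cancel against those in \<open>unit_ball_vol\<close>, and the
  powers of \<delta> leave \<open>1 / \<delta>^2\<close>.\<close>

lemma kernel_integral_eq_alpha:
  fixes \<delta> \<beta> :: real
  assumes "\<delta> > 0" and "\<beta> < real CARD('n::finite)"
  shows "nonlocal_const CARD('n) \<delta> \<beta> * (LINT z:ball (0::real^'n) \<delta>|lebesgue. norm z powr (- \<beta>))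
    = nonlocal_alpha CARD('n) \<delta> \<beta>"
proof -
  let ?n = "real CARD('n)"
  have I: "(LINT z:ball (0::real^'n) \<delta>|lebesgue. norm z powr (- \<beta>)) =
      ?n * unit_ball_vol ?n * \<delta> powr (?n - \<beta>) / (?n - \<beta>)"
    using has_bochner_integral_ball_norm_powr[where 'a = "real ^ 'n", of \<delta> \<beta>] assms
    by (simp add: set_lebesgue_integral_def has_bochner_integral_iff)
  have "\<delta> powr (?n + 2 - \<beta>) = \<delta> powr (?n - \<beta>) * \<delta>\<^sup>2"
    using powr_add[of \<delta> "?n - \<beta>" 2] assms by (simp add: add_diff_eq add.commute)
  moreover have "Gamma (?n / 2 + 1) \<noteq> 0"
  proof -
    have "?n / 2 + 1 > 0" by (simp add: add_nonneg_pos)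
    from Gamma_real_pos[OF this] show ?thesis by linarith
  qed
  ultimately show ?thesis
    using assms unfolding I nonlocal_const_def nonlocal_alpha_def unit_ball_vol_def
    by (simp add: field_simps)
qed

section \<open>The transform of the kernel\<close>

text \<open>The Fourier transform on the whole space of \<open>q\<close> cut off outside the ball,
  sampled at the torus frequencies and not normalised by the volume of the cell.\<close>

definition ball_transform :: "real ^ 'n \<Rightarrow> real \<Rightarrow> (real ^ 'n \<Rightarrow> real) \<Rightarrow> int ^ 'n \<Rightarrow> complex" where
  "ball_transform r \<delta> q k =
     (LINT z:ball 0 \<delta>|lebesgue. complex_of_real (q z) * exp (- \<i> * complex_of_real (freq r k \<bullet> z)))"

lemma set_integrable_ball_norm_powr:
  fixes \<delta> \<gamma> :: real
  assumes "\<delta> > 0" and "\<gamma> < DIM('a::euclidean_space)"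
  shows "set_integrable lebesgue (ball 0 \<delta>) (\<lambda>x::'a. norm x powr (- \<gamma>))"
  using has_bochner_integral_ball_norm_powr[OF assms]
  by (simp add: set_integrable_def has_bochner_integral_iff)

lemma norm_powr_measurable: "(\<lambda>x::'a::euclidean_space. norm x powr c) \<in> borel_measurable lebesgue"
  by (intro measurable_completion) measurable

lemma set_integrable_mult_freq_exp:
  fixes q :: "real ^ 'n \<Rightarrow> real"
  assumes "set_integrable lebesgue S q" "S \<in> sets lebesgue"
  shows "set_integrable lebesgue S (\<lambda>z. complex_of_real (q z) * exp (- \<i> * complex_of_real (freq r k \<bullet> z)))"
proof -
  have "integrable lebesgue (\<lambda>z. indicator S z *\<^sub>R q z)"
    using assms by (simp add: set_integrable_def)
  moreover have "(\<lambda>z. indicator S z *\<^sub>R (complex_of_real (q z) * exp (- \<i> * complex_of_real (freq r k \<bullet> z))))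
      \<in> borel_measurable lebesgue"
  proof -
    have "(\<lambda>z. complex_of_real (indicator S z *\<^sub>R q z) * exp (- \<i> * complex_of_real (freq r k \<bullet> z)))
      \<in> borel_measurable lebesgue"
      using calculation by (intro borel_measurable_times freq_exp_measurable 
          measurable_compose[OF _ borel_measurable_of_real]) auto
    then show ?thesis by (simp add: scaleR_conv_of_real mult.assoc)
  qed
  ultimately show ?thesis
    unfolding set_integrable_def
    by (rule Bochner_Integration.integrable_bound) (auto simp: norm_mult)
qed

lemma norm_ball_transform_le:
  assumes "set_integrable lebesgue (ball 0 \<delta>) q"
  shows "norm (ball_transform r \<delta> q k) \<le> (LINT z:ball 0 \<delta>|lebesgue. \<bar>q z\<bar>)"
proof -
  have "norm (ball_transform r \<delta> q k) \<le>
      (LINT z:ball 0 \<delta>|lebesgue. norm (complex_of_real (q z) * exp (- \<i> * complex_of_real (freq r k \<bullet> z))))"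
    unfolding ball_transform_def
    by (rule set_integral_norm_bound) (rule set_integrable_mult_freq_exp[OF assms], simp)
  also have "\<dots> = (LINT z:ball 0 \<delta>|lebesgue. \<bar>q z\<bar>)"
    by (simp add: norm_mult)
  finally show ?thesis .
qed

text \<open>The kernel is cut at radius \<rho>, and both pieces are compared with the integrable
  \<open>norm z powr (- \<gamma>)\<close>. The inner piece \<open>p\<close> contributes its L1 norm
  once for each element of \<open>F\<close>; the outer piece \<open>q\<close> is square integrable
  and is handled by Bessel and Cauchy-Schwarz. The constant depends on neither \<rho> nor
  \<open>F\<close>, so \<rho> can later be matched to the size of the frequencies.\<close>

lemma sum_ball_transform_le:
  fixes r :: "real ^ 'n" and \<delta> \<beta> \<gamma> :: real
  assumes r: "\<And>i. r $ i > 0" and \<delta>: "\<delta> > 0"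
    and \<gamma>: "\<beta> < \<gamma>" "\<gamma> < CARD('n)" "\<gamma> \<le> 2 * \<beta>"
  obtains C where "C > 0" "\<And>\<rho> F. \<rho> > 0 \<Longrightarrow> finite F \<Longrightarrow>
    (\<Sum>k\<in>F. norm (ball_transform r \<delta> (\<lambda>z. norm z powr (- \<beta>)) k))
      \<le> C * (card F * \<rho> powr (\<gamma> - \<beta>) + sqrt (card F) * \<rho> powr (\<gamma> / 2 - \<beta>))"
proof -
  obtain V where V: "V > 0" and bessel:
    "\<And>(q :: real ^ 'n \<Rightarrow> complex) F. q \<in> borel_measurable lebesgue \<Longrightarrow>
      set_integrable lebesgue (ball 0 \<delta>) (\<lambda>x. (norm (q x))\<^sup>2) \<Longrightarrow> finite F \<Longrightarrow>
      (\<Sum>k\<in>F. (norm (LINT x:ball 0 \<delta>|lebesgue. q x * exp (- \<i> * complex_of_real (freq r k \<bullet> x))))\<^sup>2)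
        \<le> V * (LINT x:ball 0 \<delta>|lebesgue. (norm (q x))\<^sup>2)"
    using bessel_ball[OF r] by blast
  define B where "B = ball (0 :: real ^ 'n) \<delta>"
  have B: "B \<in> sets lebesgue" by (simp add: B_def)
  define M where "M = (LINT z:B|lebesgue. norm z powr (- \<gamma>))"
  have M0: "M \<ge> 0"
    unfolding M_def set_lebesgue_integral_def by (intro Bochner_Integration.integral_nonneg) auto
  have int_g: "set_integrable lebesgue B (\<lambda>z. norm z powr (- \<gamma>))"
    unfolding B_def using \<gamma> \<delta> by (intro set_integrable_ball_norm_powr) auto
  \<comment> \<open>Dominates the constants of both pieces; the summand 1 makes it positive.\<close>
  define C where "C = M + sqrt (V * M) + 1"
  show ?thesis
  proof (rule that[of C])
    have "sqrt (V * M) \<ge> 0" using V M0 by simp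
    then show "C > 0" using M0 unfolding C_def by linarith
    fix \<rho> :: real and F :: "(int ^ 'n) set"
    assume \<rho>: "\<rho> > 0" and F: "finite F"
    define p where "p = (\<lambda>z :: real ^ 'n. indicator {z. norm z < \<rho>} z * norm z powr (- \<beta>))"
    define q where "q = (\<lambda>z :: real ^ 'n. indicator {z. norm z \<ge> \<rho>} z * norm z powr (- \<beta>))"
    have pm: "p \<in> borel_measurable lebesgue" and qm: "q \<in> borel_measurable lebesgue"
      unfolding p_def q_def by (intro measurable_completion; measurable)+
    \<comment> \<open>The exponent \<open>\<gamma> - \<beta>\<close> is positive, so its power of
      \<open>norm z\<close> is largest at the cut. At the origin both sides are 0.\<close>
    have p_le: "\<bar>p z\<bar> \<le> \<rho> powr (\<gamma> - \<beta>) * norm z powr (- \<gamma>)" for z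
    proof (cases "z = 0 \<or> norm z \<ge> \<rho>")
      case False
      then have "norm z powr (- \<beta>) = norm z powr (\<gamma> - \<beta>) * norm z powr (- \<gamma>)"
        by (simp add: powr_add[symmetric])
      also have "\<dots> \<le> \<rho> powr (\<gamma> - \<beta>) * norm z powr (- \<gamma>)"
        using False \<gamma> by (intro mult_right_mono powr_mono2) auto
      finally show ?thesis by (simp add: p_def indicator_def)
    qed (auto simp: p_def)
    \<comment> \<open>Here \<open>\<gamma> - 2 * \<beta>\<close> is at most 0, so the power is again
      largest at the cut.\<close>
    have q_le: "(q z)\<^sup>2 \<le> \<rho> powr (\<gamma> - 2 * \<beta>) * norm z powr (- \<gamma>)" for z
    proof (cases "norm z \<ge> \<rho>")
      case True
      then have z: "norm z > 0" using \<rho> by linarith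
      then have "(norm z powr (- \<beta>))\<^sup>2 = norm z powr (\<gamma> - 2 * \<beta>) * norm z powr (- \<gamma>)"
        by (simp add: powr_add[symmetric] power2_eq_square)
      also have "\<dots> \<le> \<rho> powr (\<gamma> - 2 * \<beta>) * norm z powr (- \<gamma>)"
        using True \<gamma> \<rho> by (intro mult_right_mono powr_mono2') auto
      finally show ?thesis using True by (simp add: q_def)
    qed (auto simp: q_def)
    have int_p: "set_integrable lebesgue B p"
      by (rule set_integrable_bound[where f = "\<lambda>z. \<rho> powr (\<gamma> - \<beta>) * norm z powr (- \<gamma>)"])
        (use int_g B pm p_le in \<open>auto simp: set_borel_measurable_def\<close>)
    have int_q2: "set_integrable lebesgue B (\<lambda>z. (q z)\<^sup>2)"
      by (rule set_integrable_bound[where f = "\<lambda>z. \<rho> powr (\<gamma> - 2 * \<beta>) * norm z powr (- \<gamma>)"])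
        (use int_g B qm q_le in \<open>auto simp: set_borel_measurable_def\<close>)
    have int_b: "set_integrable lebesgue B (\<lambda>z. norm z powr (- \<beta>))"
      unfolding B_def using \<gamma> \<delta> by (intro set_integrable_ball_norm_powr) auto
    have pq: "norm z powr (- \<beta>) = p z + q z" for z
      by (auto simp: p_def q_def indicator_def)
    have int_q: "set_integrable lebesgue B q"
      using set_integral_diff(1)[OF int_b int_p] by (simp add: pq)
    let ?T = "ball_transform r \<delta>"
    have split: "?T (\<lambda>z. norm z powr (- \<beta>)) k = ?T p k + ?T q k" for k
      unfolding ball_transform_def pq of_real_add distrib_right
      by (rule set_integral_add(2); rule set_integrable_mult_freq_exp)
        (use int_p int_q B in \<open>auto simp: B_def\<close>)
    have T_p: "norm (?T p k) \<le> M * \<rho> powr (\<gamma> - \<beta>)" for k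
    proof -
      have "norm (?T p k) \<le> (LINT z:B|lebesgue. \<bar>p z\<bar>)"
        using norm_ball_transform_le int_p unfolding B_def by blast
      also have "\<dots> \<le> (LINT z:B|lebesgue. \<rho> powr (\<gamma> - \<beta>) * norm z powr (- \<gamma>))"
        by (rule set_integral_mono) (use int_p int_g p_le in \<open>auto intro: set_integrable_abs\<close>)
      also have "\<dots> = M * \<rho> powr (\<gamma> - \<beta>)"
        by (simp add: M_def mult.commute)
      finally show ?thesis .
    qed
    have "(\<Sum>k\<in>F. (norm (?T q k))\<^sup>2) \<le> V * (LINT z:B|lebesgue. (norm (complex_of_real (q z)))\<^sup>2)"
      unfolding ball_transform_def B_def
      using int_q2 F by (intro bessel measurable_compose[OF qm borel_measurable_of_real]) (auto simp: B_def)
    also have "\<dots> \<le> V * (M * \<rho> powr (\<gamma> - 2 * \<beta>))"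
    proof (intro mult_left_mono)
      have "(LINT z:B|lebesgue. (q z)\<^sup>2) \<le> (LINT z:B|lebesgue. \<rho> powr (\<gamma> - 2 * \<beta>) * norm z powr (- \<gamma>))"
        by (rule set_integral_mono) (use int_q2 int_g q_le in auto)
      also have "\<dots> = M * \<rho> powr (\<gamma> - 2 * \<beta>)"
        by (simp add: M_def mult.commute)
      finally show "(LINT z:B|lebesgue. (norm (complex_of_real (q z)))\<^sup>2) \<le> M * \<rho> powr (\<gamma> - 2 * \<beta>)"
        by simp
    qed (use V in auto)
    finally have q2: "(\<Sum>k\<in>F. (norm (?T q k))\<^sup>2) \<le> V * M * \<rho> powr (\<gamma> - 2 * \<beta>)"
      by (simp add: mult.assoc)
    \<comment> \<open>Cauchy-Schwarz against the constant 1 on \<open>F\<close>, then Bessel for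
      \<open>q\<close>.\<close>
    have "(\<Sum>k\<in>F. norm (?T q k)) \<le> sqrt (card F) * (sqrt (V * M) * \<rho> powr (\<gamma> / 2 - \<beta>))"
    proof (rule power2_le_imp_le)
      have "(\<Sum>k\<in>F. norm (?T q k))\<^sup>2 \<le> (\<Sum>k\<in>F. (norm (?T q k))\<^sup>2) * card F"
        by (rule sum_squared_le_sum_of_squares)
      also have "\<dots> \<le> (V * M * \<rho> powr (\<gamma> - 2 * \<beta>)) * card F"
        by (intro mult_right_mono q2) auto
      also have "\<dots> = (sqrt (card F) * (sqrt (V * M) * \<rho> powr (\<gamma> / 2 - \<beta>)))\<^sup>2"
      proof -
        have "(\<rho> powr (\<gamma> / 2 - \<beta>))\<^sup>2 = \<rho> powr (\<gamma> - 2 * \<beta>)"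
          using \<rho> by (simp add: power2_eq_square powr_add[symmetric])
        then show ?thesis using V M0 by (simp add: power_mult_distrib)
      qed
      finally show "(\<Sum>k\<in>F. norm (?T q k))\<^sup>2 \<le> (sqrt (card F) * (sqrt (V * M) * \<rho> powr (\<gamma> / 2 - \<beta>)))\<^sup>2" .
    qed (use V M0 in auto)
    moreover have "(\<Sum>k\<in>F. norm (?T p k)) \<le> card F * (M * \<rho> powr (\<gamma> - \<beta>))"
      using sum_bounded_above[of F "\<lambda>k. norm (?T p k)"] T_p by simp
    moreover have "(\<Sum>k\<in>F. norm (?T (\<lambda>z. norm z powr (- \<beta>)) k)) \<le> (\<Sum>k\<in>F. norm (?T p k)) + (\<Sum>k\<in>F. norm (?T q k))"
      unfolding split sum.distrib[symmetric] by (intro sum_mono norm_triangle_ineq)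
    moreover have "card F * (M * \<rho> powr (\<gamma> - \<beta>)) \<le> C * (card F * \<rho> powr (\<gamma> - \<beta>))"
    proof -
      have "M * (card F * \<rho> powr (\<gamma> - \<beta>)) \<le> C * (card F * \<rho> powr (\<gamma> - \<beta>))"
        using V M0 by (intro mult_right_mono) (auto simp: C_def)
      then show ?thesis by (simp add: mult_ac)
    qed
    moreover have "sqrt (card F) * (sqrt (V * M) * \<rho> powr (\<gamma> / 2 - \<beta>)) \<le> C * (sqrt (card F) * \<rho> powr (\<gamma> / 2 - \<beta>))"
    proof -
      have "sqrt (V * M) * (sqrt (card F) * \<rho> powr (\<gamma> / 2 - \<beta>)) \<le> C * (sqrt (card F) * \<rho> powr (\<gamma> / 2 - \<beta>))"
        using V M0 by (intro mult_right_mono) (auto simp: C_def)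
      then show ?thesis by (simp add: mult_ac)
    qed
    ultimately show "(\<Sum>k\<in>F. norm (?T (\<lambda>z. norm z powr (- \<beta>)) k))
      \<le> C * (card F * \<rho> powr (\<gamma> - \<beta>) + sqrt (card F) * \<rho> powr (\<gamma> / 2 - \<beta>))"
      unfolding distrib_left by linarith
  qed
qed

section \<open>Lattice point count and square summability of the coefficients\<close>

text \<open>The ball lies in a cube with \<open>2 * m + 1\<close> choices for each coordinate, where
  \<open>m\<close> is the integer part of \<open>R\<close>; since \<open>R \<ge> 1\<close> this is
  at most \<open>3 * R\<close>. Only the order of growth matters later.\<close>

lemma int_norm_ball:
  fixes R :: real
  assumes R: "R \<ge> 1"
  shows "finite {k :: int ^ 'n. int_norm k < R}"
    and "card {k :: int ^ 'n. int_norm k < R} \<le> (3 * R) ^ CARD('n)"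
proof -
  define m where "m = \<lfloor>R\<rfloor>"
  let ?P = "PiE (UNIV :: 'n set) (\<lambda>_. {-m..m})"
  have sub: "vec_nth ` {k :: int ^ 'n. int_norm k < R} \<subseteq> ?P"
  proof clarify
    fix k :: "int ^ 'n" assume k: "int_norm k < R"
    have "\<bar>real_of_int (k $ i)\<bar> \<le> int_norm k" for i
      using component_le_norm_cart[of "\<chi> i. real_of_int (k $ i)" i] by (simp add: int_norm_def)
    then have "\<bar>real_of_int (k $ i)\<bar> \<le> R" for i using k by (meson less_imp_le order_trans)
    then have "\<bar>k $ i\<bar> \<le> m" for i by (simp add: m_def le_floor_iff)
    then show "vec_nth k \<in> ?P" by (auto simp: abs_le_iff minus_le_iff)
  qed
  have inj: "inj_on vec_nth {k :: int ^ 'n. int_norm k < R}"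
    by (simp add: inj_on_def vec_eq_iff)
  have fin: "finite ?P" by (intro finite_PiE) auto
  show "finite {k :: int ^ 'n. int_norm k < R}"
    using inj_on_finite[OF inj sub fin] .
  have "card {k :: int ^ 'n. int_norm k < R} \<le> card ?P"
    using card_inj_on_le[OF inj sub fin] .
  also have "\<dots> = nat (2 * m + 1) ^ CARD('n)"
    by (simp add: card_PiE)
  finally have "real (card {k :: int ^ 'n. int_norm k < R}) \<le> real (nat (2 * m + 1)) ^ CARD('n)"
    by (metis of_nat_le_iff of_nat_power)
  also have "\<dots> \<le> (3 * R) ^ CARD('n)"
  proof (intro power_mono)
    have "real_of_int m \<le> R" by (simp add: m_def)
    moreover have "m \<ge> 0" using R by (simp add: m_def)
    ultimately show "real (nat (2 * m + 1)) \<le> 3 * R" using R by simp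
  qed simp
  finally show "card {k :: int ^ 'n. int_norm k < R} \<le> (3 * R) ^ CARD('n)" .
qed

lemma bessel_fourier_coeff:
  fixes r :: "real ^ 'n"
  assumes r: "\<And>i. r $ i > 0" and f: "torus_L2 r f"
  obtains B where "\<And>F. finite F \<Longrightarrow> (\<Sum>k\<in>F. (norm (fourier_coeff r f k))\<^sup>2) \<le> B"
proof -
  define V where "V = (\<Prod>i\<in>UNIV. r $ i)"
  have V: "V > 0" unfolding V_def using r by (intro prod_pos) auto
  let ?I = "LINT x:cbox 0 r|lebesgue. (norm (f x))\<^sup>2"
  show ?thesis
  proof (rule that[of "V * ?I / V\<^sup>2"])
    fix F :: "(int ^ 'n) set" assume F: "finite F"
    have "(\<Sum>k\<in>F. (norm (LINT x:cbox 0 r|lebesgue. f x * exp (- \<i> * complex_of_real (freq r k \<bullet> x))))\<^sup>2) \<le> V * ?I"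
      using bessel_box[OF r F, of f 0] f by (simp add: torus_L2_def V_def)
    moreover have "norm (fourier_coeff r f k) =
        norm (LINT x:cbox 0 r|lebesgue. f x * exp (- \<i> * complex_of_real (freq r k \<bullet> x))) / V" for k
      unfolding fourier_coeff_def V_def[symmetric] norm_divide using V by simp
    ultimately show "(\<Sum>k\<in>F. (norm (fourier_coeff r f k))\<^sup>2) \<le> V * ?I / V\<^sup>2"
      using V by (simp add: power_divide sum_divide_distrib[symmetric] divide_right_mono)
  qed
qed

section \<open>Bounds for the multiplier\<close>

lemma nonlocal_const_pos:
  fixes \<delta> \<beta> :: real
  assumes "\<delta> > 0" "\<beta> < real n"
  shows "nonlocal_const n \<delta> \<beta> > 0"
proof -
  have "real n / 2 + 1 > 0" by (simp add: add_nonneg_pos)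
  from Gamma_real_pos[OF this] show ?thesis
    using assms by (simp add: nonlocal_const_def)
qed

text \<open>The integrand is nonpositive because the cosine is at most 1. The sign puts the
  exponents in the range where \<open>abs_exp_diff_le\<close> applies.\<close>

lemma multiplier_nonpos:
  fixes \<nu> :: "real ^ 'n" and \<delta> \<beta> :: real
  assumes "\<delta> > 0" "\<beta> < CARD('n)"
  shows "multiplier \<delta> \<beta> \<nu> \<le> 0"
proof -
  have "(LINT z:ball 0 \<delta>|lebesgue. - ((cos (\<nu> \<bullet> z) - 1) / norm z powr \<beta>)) \<ge> 0"
    unfolding set_lebesgue_integral_def
    by (intro Bochner_Integration.integral_nonneg)
      (simp add: divide_le_0_iff mult_le_0_iff indicator_def)
  then have "(LINT z:ball 0 \<delta>|lebesgue. (cos (\<nu> \<bullet> z) - 1) / norm z powr \<beta>) \<le> 0"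
    by (simp add: set_lebesgue_integral_def)
  then show ?thesis
    unfolding multiplier_def using nonlocal_const_pos[OF assms]
    by (intro mult_nonneg_nonpos) auto
qed

text \<open>Splitting \<open>cos - 1\<close> under the integral, the part with \<open>- 1\<close>
  gives \<open>- \<alpha>\<close> and the part with the cosine gives the constant times the real
  part of the transform.\<close>

lemma multiplier_add_alpha:
  fixes r :: "real ^ 'n" and \<delta> \<beta> :: real
  assumes \<delta>: "\<delta> > 0" and \<beta>: "\<beta> < CARD('n)"
  shows "\<bar>multiplier \<delta> \<beta> (freq r k) + nonlocal_alpha CARD('n) \<delta> \<beta>\<bar>
    \<le> nonlocal_const CARD('n) \<delta> \<beta> * norm (ball_transform r \<delta> (\<lambda>z. norm z powr (- \<beta>)) k)"
proof -
  let ?c = "nonlocal_const CARD('n) \<delta> \<beta>"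
  let ?K = "\<lambda>z :: real ^ 'n. norm z powr (- \<beta>)"
  let ?B = "ball (0 :: real ^ 'n) \<delta>"
  let ?T = "ball_transform r \<delta> ?K k"
  let ?h = "\<lambda>z. complex_of_real (?K z) * exp (- \<i> * complex_of_real (freq r k \<bullet> z))"
  have K: "set_integrable lebesgue ?B ?K"
    using \<beta> by (intro set_integrable_ball_norm_powr[OF \<delta>]) simp
  have h: "set_integrable lebesgue ?B ?h"
    by (rule set_integrable_mult_freq_exp[OF K]) simp
  have Re_h: "Re (?h z) = cos (freq r k \<bullet> z) * ?K z" for z
    by (simp add: Re_exp Im_exp)
  have cosK: "set_integrable lebesgue ?B (\<lambda>z. cos (freq r k \<bullet> z) * ?K z)"
    using integrable_Re[OF h[unfolded set_integrable_def]]
    unfolding set_integrable_def by (simp only: scaleR_complex.sel Re_h real_scaleR_def)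
  have "Re ?T = (LINT z:?B|lebesgue. cos (freq r k \<bullet> z) * ?K z)"
    using integral_Re[OF h[unfolded set_integrable_def]]
    unfolding ball_transform_def set_lebesgue_integral_def
    by (simp only: scaleR_complex.sel Re_h real_scaleR_def)
  moreover have "(LINT z:?B|lebesgue. (cos (freq r k \<bullet> z) - 1) / norm z powr \<beta>)
      = (LINT z:?B|lebesgue. cos (freq r k \<bullet> z) * ?K z) - (LINT z:?B|lebesgue. ?K z)"
    by (subst set_integral_diff(2)[OF cosK K, symmetric]) (simp add: powr_minus_divide left_diff_distrib diff_divide_distrib)
  ultimately have "multiplier \<delta> \<beta> (freq r k) + ?c * (LINT z:?B|lebesgue. ?K z) = ?c * Re ?T"
    by (simp add: multiplier_def right_diff_distrib)
  then have "multiplier \<delta> \<beta> (freq r k) + nonlocal_alpha CARD('n) \<delta> \<beta> = ?c * Re ?T"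
    using kernel_integral_eq_alpha[where 'n = 'n, OF \<delta>] \<beta> by simp
  then show ?thesis
    using nonlocal_const_pos[OF \<delta> \<beta>] abs_Re_le_cmod[of ?T] by (simp add: abs_mult mult_left_mono)
qed

text \<open>On the nonpositive half-line the exponential has slope at most 1.\<close>

lemma abs_exp_diff_le:
  fixes x y :: real
  assumes "x \<le> 0" "y \<le> 0"
  shows "\<bar>exp x - exp y\<bar> \<le> \<bar>x - y\<bar>"
proof -
  have *: "exp b - exp a \<le> b - a" if "a \<le> b" "b \<le> 0" for a b :: real
  proof -
    have "exp b - exp a = exp b * (1 - exp (a - b))"
      by (simp add: exp_diff right_diff_distrib)
    also have "\<dots> \<le> 1 * (1 - exp (a - b))"
      using that by (intro mult_right_mono) auto
    also have "\<dots> \<le> b - a" using exp_ge_add_one_self[of "a - b"] by (simp only: mult_1_left)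
    finally show ?thesis .
  qed
  show ?thesis using *[of x y] *[of y x] assms by (cases "x \<le> y") auto
qed

section \<open>Summability of coefficients times transforms\<close>

text \<open>The square of the kernel is \<open>norm z powr (- (2 * \<beta>))\<close>, integrable on
  the ball as \<open>2 * \<beta>\<close> is below the dimension. Bessel bounds both sums of squares,
  and \<open>x * y \<le> x^2 + y^2\<close> bounds the sum of products.\<close>

lemma summable_coeff_transform_L2:
  fixes r :: "real ^ 'n" and \<delta> \<beta> :: real
  assumes r: "\<And>i. r $ i > 0" and f: "torus_L2 r f" and \<delta>: "\<delta> > 0" and \<beta>: "2 * \<beta> < CARD('n)"
  shows "(\<lambda>k. norm (fourier_coeff r f k) * norm (ball_transform r \<delta> (\<lambda>z. norm z powr (- \<beta>)) k)) summable_on UNIV"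
proof -
  let ?T = "ball_transform r \<delta> (\<lambda>z. norm z powr (- \<beta>))"
  obtain B where B: "\<And>F. finite F \<Longrightarrow> (\<Sum>k\<in>F. (norm (fourier_coeff r f k))\<^sup>2) \<le> B"
    using bessel_fourier_coeff[OF r f] by blast
  obtain V where bessel:
    "\<And>(q :: real ^ 'n \<Rightarrow> complex) F. q \<in> borel_measurable lebesgue \<Longrightarrow>
      set_integrable lebesgue (ball 0 \<delta>) (\<lambda>x. (norm (q x))\<^sup>2) \<Longrightarrow> finite F \<Longrightarrow>
      (\<Sum>k\<in>F. (norm (LINT x:ball 0 \<delta>|lebesgue. q x * exp (- \<i> * complex_of_real (freq r k \<bullet> x))))\<^sup>2)
        \<le> V * (LINT x:ball 0 \<delta>|lebesgue. (norm (q x))\<^sup>2)"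
    using bessel_ball[OF r] by blast
  have sq: "(norm (complex_of_real (norm z powr (- \<beta>))))\<^sup>2 = norm z powr (- (2 * \<beta>))" for z :: "real ^ 'n"
    by (simp add: power2_eq_square powr_add[symmetric])
  define B' where "B' = V * (LINT z:ball (0 :: real ^ 'n) \<delta>|lebesgue. norm z powr (- (2 * \<beta>)))"
  have B': "(\<Sum>k\<in>F. (norm (?T k))\<^sup>2) \<le> B'" if "finite F" for F
    unfolding ball_transform_def B'_def sq[symmetric]
  proof (rule bessel[OF _ _ that])
    show "(\<lambda>z :: real ^ 'n. complex_of_real (norm z powr - \<beta>)) \<in> borel_measurable lebesgue"
      by (rule measurable_compose[OF norm_powr_measurable borel_measurable_of_real])
    show "set_integrable lebesgue (ball (0 :: real ^ 'n) \<delta>) (\<lambda>z. (norm (complex_of_real (norm z powr - \<beta>)))\<^sup>2)"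
      unfolding sq using \<beta> by (intro set_integrable_ball_norm_powr[OF \<delta>]) simp
  qed
  show ?thesis
  proof (rule nonneg_bdd_above_summable_on)
    show "bdd_above (sum (\<lambda>k. norm (fourier_coeff r f k) * norm (?T k)) ` {F. F \<subseteq> UNIV \<and> finite F})"
    proof (rule bdd_aboveI2)
      fix F :: "(int ^ 'n) set" assume "F \<in> {F. F \<subseteq> UNIV \<and> finite F}"
      then have F: "finite F" by simp
      have "x * y \<le> x\<^sup>2 + y\<^sup>2" for x y :: real
        using sum_squares_bound[of x y] zero_le_power2[of x] zero_le_power2[of y] sum_squares_bound[of "-x" y] by linarith
      then have "(\<Sum>k\<in>F. norm (fourier_coeff r f k) * norm (?T k))
          \<le> (\<Sum>k\<in>F. (norm (fourier_coeff r f k))\<^sup>2 + (norm (?T k))\<^sup>2)"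
        by (intro sum_mono) auto
      also have "\<dots> \<le> B + B'"
        using B[OF F] B'[OF F] by (simp add: sum.distrib)
      finally show "(\<Sum>k\<in>F. norm (fourier_coeff r f k) * norm (?T k)) \<le> B + B'" .
    qed
  qed auto
qed

text \<open>At scale \<open>x = 2^l\<close> there are of order \<open>x^n\<close> frequencies. With
  \<open>\<rho> = 1 / x\<close> and \<open>\<gamma> = n - \<eta>\<close> their transforms sum to
  order \<open>x powr (\<beta> + \<eta>)\<close>, and the decay of \<open>a\<close> leaves
  \<open>x powr (\<eta> - \<epsilon>)\<close>, a geometric sequence in \<open>l\<close>.\<close>

lemma summable_coeff_transform_decay:
  fixes r :: "real ^ 'n" and \<delta> \<beta> \<epsilon> :: real and a :: "int ^ 'n \<Rightarrow> complex"
  assumes r: "\<And>i. r $ i > 0" and \<delta>: "\<delta> > 0"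
    and \<beta>: "CARD('n) \<le> 2 * \<beta>" "\<beta> < CARD('n)" and \<epsilon>: "\<epsilon> > 0"
    and a: "eventually (\<lambda>k. norm (a k) \<le> A * int_norm k powr (- (\<beta> + \<epsilon>))) int_vec_at_infinity"
  shows "(\<lambda>k. norm (a k) * norm (ball_transform r \<delta> (\<lambda>z. norm z powr (- \<beta>)) k)) summable_on UNIV"
proof -
  let ?T = "ball_transform r \<delta> (\<lambda>z. norm z powr (- \<beta>))"
  let ?n = "real CARD('n)"
  \<comment> \<open>a loss of \<open>\<eta> < \<epsilon>\<close> in the exponents avoids the logarithm that occurs for \<open>2 * \<beta> = n\<close>\<close>
  define \<eta> where "\<eta> = min \<epsilon> (?n - \<beta>) / 2"
  define \<gamma> where "\<gamma> = ?n - \<eta>"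
  have \<eta>: "0 < \<eta>" "\<eta> < \<epsilon>" "\<eta> < ?n - \<beta>"
    using \<epsilon> \<beta> by (auto simp: \<eta>_def min_def)
  \<comment> \<open>The three bounds come from \<open>\<eta> < n - \<beta>\<close>, from
    \<open>\<eta> > 0\<close>, and from \<open>n \<le> 2 * \<beta>\<close>.\<close>
  have \<gamma>: "\<beta> < \<gamma>" "\<gamma> < CARD('n)" "\<gamma> \<le> 2 * \<beta>"
    using \<eta> \<beta> by (auto simp: \<gamma>_def)
  obtain C where C: "C > 0" "\<And>\<rho> F. \<rho> > 0 \<Longrightarrow> finite F \<Longrightarrow> (\<Sum>k\<in>F. norm (?T k))
      \<le> C * (card F * \<rho> powr (\<gamma> - \<beta>) + sqrt (card F) * \<rho> powr (\<gamma> / 2 - \<beta>))"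
    using sum_ball_transform_le[OF r \<delta> \<gamma>] by blast
  obtain R0 where R0: "\<And>k. int_norm k \<ge> R0 \<Longrightarrow> norm (a k) \<le> A * int_norm k powr (- (\<beta> + \<epsilon>))"
    using a by (auto simp: int_vec_at_infinity_def eventually_filtercomap eventually_at_top_linorder)
  \<comment> \<open>With \<open>R \<ge> 1\<close> the dyadic logarithm of \<open>int_norm k\<close>
    is nonnegative beyond \<open>R\<close>.\<close>
  define R where "R = max 1 R0"
  define A' where "A' = max A 0"
  have a_le: "norm (a k) \<le> A' * int_norm k powr (- (\<beta> + \<epsilon>))" if "int_norm k \<ge> R" for k
  proof -
    have "norm (a k) \<le> A * int_norm k powr (- (\<beta> + \<epsilon>))" using that by (intro R0) (simp add: R_def)
    also have "\<dots> \<le> A' * int_norm k powr (- (\<beta> + \<epsilon>))" by (intro mult_right_mono) (auto simp: A'_def)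
    finally show ?thesis .
  qed
  have A': "A' \<ge> 0" by (simp add: A'_def)
  \<comment> \<open>The shell lies in the ball of radius \<open>2 * x\<close>, so the count is at
    most \<open>(3 * (2 * x))^n\<close>, which is \<open>D * x^n\<close>.\<close>
  define D where "D = (6::real) ^ CARD('n)"
  have D: "D \<ge> 0" by (simp add: D_def)
  define \<theta> where "\<theta> = 2 powr (\<eta> - \<epsilon>)"
  have \<theta>: "0 < \<theta>" "\<theta> < 1" using \<eta> by (auto simp: \<theta>_def powr_less_one)
  define C1 where "C1 = A' * C * (D + sqrt D)"
  have C1: "C1 \<ge> 0" using A' C D by (simp add: C1_def)
  have shell: "(\<Sum>k\<in>F. norm (a k) * norm (?T k)) \<le> C1 * \<theta> ^ l"
    if F: "finite F" "\<And>k. k \<in> F \<Longrightarrow> R \<le> int_norm k \<and> 2 ^ l \<le> int_norm k \<and> int_norm k < 2 ^ Suc l" for F l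
  proof -
    define x where "x = (2::real) ^ l"
    have x: "x \<ge> 1" by (simp add: x_def)
    have xp: "x = 2 powr real l" by (simp add: x_def powr_realpow)
    have "card F \<le> card {k :: int ^ 'n. int_norm k < 2 ^ Suc l}"
    proof (rule card_mono[OF int_norm_ball(1)])
      show "(1::real) \<le> 2 ^ Suc l" by (rule one_le_power) simp
    qed (use F in auto)
    also have "real \<dots> \<le> (3 * 2 ^ Suc l) ^ CARD('n)"
      by (rule int_norm_ball(2), rule one_le_power) simp
    also have "(3 * 2 ^ Suc l) ^ CARD('n) = (6 * x) ^ CARD('n)" by (simp add: x_def)
    also have "\<dots> = D * x powr ?n"
      using x by (subst powr_realpow) (simp_all add: D_def power_mult_distrib)
    finally have card: "real (card F) \<le> D * x powr ?n" by simp
    have scard: "sqrt (card F) \<le> sqrt D * x powr (?n / 2)"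
    proof -
      have "sqrt (card F) \<le> sqrt (D * x powr ?n)" using card by simp
      also have "sqrt (x powr ?n) = x powr (?n / 2)"
        using x by (simp add: powr_half_sqrt[symmetric] powr_powr)
      then have "sqrt (D * x powr ?n) = sqrt D * x powr (?n / 2)" by (simp add: real_sqrt_mult)
      finally show ?thesis .
    qed
    have "(\<Sum>k\<in>F. norm (a k) * norm (?T k)) \<le> (\<Sum>k\<in>F. (A' * x powr (- (\<beta> + \<epsilon>))) * norm (?T k))"
    proof (intro sum_mono mult_right_mono)
      fix k assume k: "k \<in> F"
      have "norm (a k) \<le> A' * int_norm k powr (- (\<beta> + \<epsilon>))" using F(2)[OF k] by (intro a_le) auto
      also have "\<dots> \<le> A' * x powr (- (\<beta> + \<epsilon>))"
        using F(2)[OF k] x A' \<beta> \<epsilon> by (intro mult_left_mono powr_mono2') (auto simp: x_def)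
      finally show "norm (a k) \<le> A' * x powr (- (\<beta> + \<epsilon>))" .
    qed auto
    also have "\<dots> = (A' * x powr (- (\<beta> + \<epsilon>))) * (\<Sum>k\<in>F. norm (?T k))"
      by (simp add: sum_distrib_left)
    \<comment> \<open>The kernel is cut at radius \<open>1 / x\<close>, the scale of the wavelengths
      in this shell.\<close>
    also have "\<dots> \<le> (A' * x powr (- (\<beta> + \<epsilon>))) *
        (C * ((D * x powr ?n) * (1 / x) powr (\<gamma> - \<beta>) + (sqrt D * x powr (?n / 2)) * (1 / x) powr (\<gamma> / 2 - \<beta>)))"
    proof (rule mult_left_mono)
      have "(\<Sum>k\<in>F. norm (?T k)) \<le> C * (card F * (1 / x) powr (\<gamma> - \<beta>) + sqrt (card F) * (1 / x) powr (\<gamma> / 2 - \<beta>))"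
        using x F(1) by (intro C(2)) auto
      also have "\<dots> \<le> C * ((D * x powr ?n) * (1 / x) powr (\<gamma> - \<beta>) + (sqrt D * x powr (?n / 2)) * (1 / x) powr (\<gamma> / 2 - \<beta>))"
        using C(1) card scard by (intro mult_left_mono add_mono mult_right_mono) auto
      finally show "(\<Sum>k\<in>F. norm (?T k)) \<le> \<dots>" .
    qed (use A' in simp)
    also have "\<dots> = A' * C * (D * x powr (\<eta> - \<epsilon>) + sqrt D * x powr (\<eta> / 2 - \<epsilon>))"
    proof -
      have inv: "(1 / x) powr c = x powr (- c)" for c
        using x by (simp add: powr_divide powr_minus_divide)
      have "x powr (- (\<beta> + \<epsilon>)) * (x powr ?n * x powr (- (\<gamma> - \<beta>))) = x powr (\<eta> - \<epsilon>)"
        unfolding powr_add[symmetric] by (simp add: \<gamma>_def)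
      moreover have "x powr (- (\<beta> + \<epsilon>)) * (x powr (?n / 2) * x powr (- (\<gamma> / 2 - \<beta>))) = x powr (\<eta> / 2 - \<epsilon>)"
        unfolding powr_add[symmetric] by (simp add: \<gamma>_def diff_divide_distrib)
      moreover have "(A' * p) * (C * ((D * u) * v + (sqrt D * u') * v')) =
          A' * C * (D * (p * (u * v)) + sqrt D * (p * (u' * v')))" for p u v u' v' :: real
        by (simp add: algebra_simps)
      ultimately show ?thesis unfolding inv by presburger
    qed
    \<comment> \<open>Since \<open>x \<ge> 1\<close>, the inner piece, with the larger exponent,
      dominates.\<close>
    also have "\<dots> \<le> A' * C * (D * x powr (\<eta> - \<epsilon>) + sqrt D * x powr (\<eta> - \<epsilon>))"
      using A' C D x \<eta> by (intro mult_left_mono add_mono powr_mono) auto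
    also have "\<dots> = C1 * x powr (\<eta> - \<epsilon>)" by (simp add: C1_def algebra_simps)
    also have "x powr (\<eta> - \<epsilon>) = \<theta> ^ l"
      unfolding xp \<theta>_def by (simp add: powr_powr powr_realpow[symmetric] mult.commute)
    finally show ?thesis .
  qed
  define K0 where "K0 = {k :: int ^ 'n. int_norm k < R}"
  have K0: "finite K0" unfolding K0_def by (rule int_norm_ball(1)) (simp add: R_def)
  have "(\<lambda>k. norm (a k) * norm (?T k)) summable_on (- K0)"
  proof (rule nonneg_bdd_above_summable_on)
    show "bdd_above (sum (\<lambda>k. norm (a k) * norm (?T k)) ` {F. F \<subseteq> - K0 \<and> finite F})"
    proof (rule bdd_aboveI2)
      fix F :: "(int ^ 'n) set" assume "F \<in> {F. F \<subseteq> - K0 \<and> finite F}"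
      then have F: "F \<subseteq> - K0" "finite F" by auto
      \<comment> \<open>The dyadic shell containing \<open>k\<close>.\<close>
      define l where "l = (\<lambda>k :: int ^ 'n. nat \<lfloor>log 2 (int_norm k)\<rfloor>)"
      have l: "2 ^ l k \<le> int_norm k \<and> int_norm k < 2 ^ Suc (l k)" if "int_norm k \<ge> R" for k
      proof -
        have k: "int_norm k \<ge> 1" using that by (simp add: R_def)
        then have "log 2 (int_norm k) \<ge> 0" by simp
        then have "real (l k) \<le> log 2 (int_norm k)" "log 2 (int_norm k) < real (Suc (l k))"
          by (simp_all add: l_def) linarith+
        then have "2 powr real (l k) \<le> int_norm k" "int_norm k < 2 powr real (Suc (l k))"
          using k by (simp_all add: le_log_iff log_less_iff del: of_nat_Suc)
        then show ?thesis by (simp only: powr_realpow zero_less_numeral)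
      qed
      \<comment> \<open>Grouping by shells bounds every finite sum by the full geometric
        series.\<close>
      have "(\<Sum>k\<in>F. norm (a k) * norm (?T k)) =
          (\<Sum>j\<in>l ` F. \<Sum>k\<in>{k \<in> F. l k = j}. norm (a k) * norm (?T k))"
        by (rule sum.image_gen[OF F(2)])
      also have "\<dots> \<le> (\<Sum>j\<in>l ` F. C1 * \<theta> ^ j)"
      proof (rule sum_mono)
        fix j
        show "(\<Sum>k\<in>{k \<in> F. l k = j}. norm (a k) * norm (?T k)) \<le> C1 * \<theta> ^ j"
        proof (rule shell)
          fix k assume "k \<in> {k \<in> F. l k = j}"
          then have "int_norm k \<ge> R" "l k = j" using F(1) by (auto simp: K0_def)
          then show "R \<le> int_norm k \<and> 2 ^ j \<le> int_norm k \<and> int_norm k < 2 ^ Suc j"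
            using l by blast
        qed (use F(2) in simp)
      qed
      also have "\<dots> \<le> (\<Sum>j. C1 * \<theta> ^ j)"
        using \<theta> C1 F(2) by (intro sum_le_suminf summable_mult summable_geometric) auto
      finally show "(\<Sum>k\<in>F. norm (a k) * norm (?T k)) \<le> (\<Sum>j. C1 * \<theta> ^ j)" .
    qed
  qed auto
  then have "(\<lambda>k. norm (a k) * norm (?T k)) summable_on (- K0 \<union> K0)"
    using K0 by (intro summable_on_Un_disjoint) auto
  then show ?thesis by (simp add: Un_commute)
qed

section \<open>Persistence of discontinuities\<close>

theorem theorem15:
  fixes r x :: "real ^ 'n"
    and \<delta> \<beta> \<epsilon> \<zeta> :: real
    and f :: "real ^ 'n \<Rightarrow> complex"
    and u v :: "real \<Rightarrow> real ^ 'n \<Rightarrow> complex"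
  assumes "\<And>i. r $ i > 0"
    and "\<delta> > 0"
    and "\<beta> < real CARD('n)"
    and "torus_L2 r f"
    and "nonlocal_solution r \<delta> \<beta> f u"
    and "\<And>t. t > 0 \<Longrightarrow> is_v_part r \<delta> \<beta> f t (v t)"
    and "\<And>t y. t > 0 \<Longrightarrow>
           u t y = v t y + complex_of_real (exp (- nonlocal_alpha CARD('n) \<delta> \<beta> * t)) * f y"
    and "\<epsilon> > 0" and "\<zeta> > 0"
    and "fourier_coeff r f \<sim>[int_vec_at_infinity]
           (\<lambda>k. complex_of_real
              (if (real CARD('n) - 1) / 2 < \<beta>
               then 1 / int_norm k powr (\<beta> + \<epsilon>)
               else 1 / int_norm k powr ((real CARD('n) - 1) / 2 + \<zeta>)))"
    and "\<not> isCont f x"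
  shows "\<forall>t>0. \<not> isCont (u t) x"
proof (intro allI impI notI)
  fix t :: real
  assume t: "t > 0" and cont_u: "isCont (u t) x"
  note r = assms(1) and \<delta> = assms(2) and \<beta> = assms(3)
  let ?n = "real CARD('n)" and ?\<alpha> = "nonlocal_alpha CARD('n) \<delta> \<beta>"
  let ?c = "nonlocal_const CARD('n) \<delta> \<beta>" and ?m = "\<lambda>k. multiplier \<delta> \<beta> (freq r k)"
  let ?T = "ball_transform r \<delta> (\<lambda>z. norm z powr (- \<beta>))"
  have v: "torus_L2 r (v t)"
    and v_coeff: "\<And>k. fourier_coeff r (v t) k = fourier_coeff r f k *
        complex_of_real ((1 - exp (- (?m k + ?\<alpha>) * t)) * exp (?m k * t))"
    and v_cont: "\<And>g. continuous_on UNIV g \<Longrightarrow> torus_periodic r g \<Longrightarrow>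
        AE x in lebesgue. g x = v t x \<Longrightarrow> v t = g"
    using assms(6)[OF t] unfolding is_v_part_def by blast+
  have sum: "(\<lambda>k. norm (fourier_coeff r f k) * norm (?T k)) summable_on UNIV"
  proof (cases "2 * \<beta> < ?n")
    case True
    then show ?thesis using summable_coeff_transform_L2[OF r assms(4) \<delta>] by simp
  next
    case False
    \<comment> \<open>Here \<open>2 * \<beta> \<ge> n\<close>, so the hypothesis on the coefficients
      is in its first case, with decay exponent \<open>\<beta> + \<epsilon>\<close>.\<close>
    then have "(?n - 1) / 2 < \<beta>" by simp
    with assms(10) have "fourier_coeff r f \<sim>[int_vec_at_infinity]
        (\<lambda>k. complex_of_real (1 / int_norm k powr (\<beta> + \<epsilon>)))" by simp
    from landau_o.bigE[OF asymp_equiv_imp_bigo[OF this]] obtain A where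
      "eventually (\<lambda>k. norm (fourier_coeff r f k) \<le> A * norm (complex_of_real (1 / int_norm k powr (\<beta> + \<epsilon>)))) int_vec_at_infinity"
      by blast
    then have "eventually (\<lambda>k. norm (fourier_coeff r f k) \<le> A * int_norm k powr (- (\<beta> + \<epsilon>))) int_vec_at_infinity"
      by (simp add: powr_minus_divide norm_divide del: minus_add_distrib)
    then show ?thesis
      using False \<beta> by (intro summable_coeff_transform_decay[OF r \<delta> _ _ assms(8)]) auto
  qed
  have bound: "norm (fourier_coeff r (v t) k) \<le> t * ?c * (norm (fourier_coeff r f k) * norm (?T k))" for k
  proof -
    have "?\<alpha> \<ge> 0" using \<beta> \<delta> by (simp add: nonlocal_alpha_def)
    \<comment> \<open>The factor is a difference of two exponentials with nonpositive exponents
      whose distance is \<open>t * |m + \<alpha>|\<close>, which the transform of the kernel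
      controls.\<close>
    have "(1 - exp (- (?m k + ?\<alpha>) * t)) * exp (?m k * t) = exp (?m k * t) - exp (- ?\<alpha> * t)"
      by (simp add: left_diff_distrib exp_add[symmetric] algebra_simps)
    then have "\<bar>(1 - exp (- (?m k + ?\<alpha>) * t)) * exp (?m k * t)\<bar> \<le> \<bar>?m k * t - (- ?\<alpha> * t)\<bar>"
      using t \<open>?\<alpha> \<ge> 0\<close> multiplier_nonpos[OF \<delta> \<beta>]
      by (simp only:) (intro abs_exp_diff_le; simp add: mult_nonpos_nonneg)
    also have "\<dots> = t * \<bar>?m k + ?\<alpha>\<bar>"
      using t abs_mult_pos[of t "?m k + ?\<alpha>"] by (simp add: distrib_right distrib_left mult.commute)
    also have "\<dots> \<le> t * (?c * norm (?T k))"
      using t multiplier_add_alpha[OF \<delta> \<beta>] by (intro mult_left_mono) auto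
    finally have "norm (fourier_coeff r f k) * \<bar>(1 - exp (- (?m k + ?\<alpha>) * t)) * exp (?m k * t)\<bar>
        \<le> norm (fourier_coeff r f k) * (t * (?c * norm (?T k)))"
      by (intro mult_left_mono) auto
    then show ?thesis
      unfolding v_coeff norm_mult norm_of_real by (simp only: mult_ac)
  qed
  have "(\<lambda>k. norm (fourier_coeff r (v t) k)) summable_on UNIV"
    by (rule summable_on_comparison_test[OF summable_on_cmult_right[OF sum] bound]) auto
  then obtain g where g: "continuous_on UNIV g" "torus_periodic r g" "AE x in lebesgue. g x = v t x"
    using continuous_representative_of_summable_coeffs[OF r v] by blast
  \<comment> \<open>By the choice of representative, \<open>v t\<close> equals \<open>g\<close>
    everywhere and not merely almost everywhere, which makes continuity at the single point
    \<open>x\<close> meaningful.\<close>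
  then have "isCont (v t) x"
    using v_cont[OF g] by (simp add: continuous_on_eq_continuous_at)
  \<comment> \<open>Solving \<open>u = v + exp (- \<alpha> * t) * f\<close> for \<open>f\<close>
    expresses it through functions continuous at \<open>x\<close>.\<close>
  then have "isCont (\<lambda>y. (u t y - v t y) * complex_of_real (exp (?\<alpha> * t))) x"
    using cont_u by (intro continuous_intros)
  moreover have "(\<lambda>y. (u t y - v t y) * complex_of_real (exp (?\<alpha> * t))) = f"
    using assms(7)[OF t] by (simp add: fun_eq_iff exp_of_real[symmetric] exp_add[symmetric] mult_ac)
  ultimately have "isCont f x" by simp
  with assms(11) show False ..
qed

end
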